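(* Let $n \ge 2$ and $2 \le k \le n$ be integers, let $0 = n_0 < n_1 < \cdots < n_{k-1} < n_k = n$ be integers, and put $r_j = n_j - n_{j-1}$ for $j = 1, \ldots, k$. Let $a < b$ be real numbers. Let $X_1, \ldots, X_k$ be independent random variables, independent of the weights $(V_1,\ldots,V_k)$, such that $X_i$ has the $\widetilde{beta}(r_i + 1/2,\, r_i + 1/2)$ distribution over $[a,b]$ for each $i = 1, \ldots, k$. Then the randomly weighted average $$S_{n:n_1,\ldots,n_{k-1}} = \sum_{j=1}^{k} V_j X_j$$ has the $\widetilde{beta}\left(\sum_{i=1}^{k} r_i + 1/2,\ \sum_{i=1}^{k} r_i + 1/2\right)$ distribution over $[a,b]$.
   Context: Random weights: let $U_{(1)} < U_{(2)} < \cdots < U_{(n-1)}$ be the order statistics of a random sample of size $n-1$ from the uniform distribution on $(0,1)$, with the conventions $U_{(0)} = 0$ and $U_{(n)} = 1$. For integers $0 = n_0 < n_1 < \cdots < n_{k-1} < n_k = n$ set $V_j = U_{(n_j)} - U_{(n_{j-1})}$, $j = 1, \ldots, k$ (so $V_1 + \cdots + V_k = 1$, and $(V_1,\ldots,V_k)$ has the Dirichlet distribution with parameters $(r_1, \ldots, r_k)$, where $r_j = n_j - n_{j-1}$ and $\sum_j r_j = n$). Beta distribution over $[a,b]$: for real $a<b$ and $p, q > 0$, $\widetilde{beta}(p,q)$ denotes the probability distribution with density $$f_{p,q}(x) = \frac{1}{B(p,q)\,(b-a)^{p+q-1}} (x-a)^{p-1}(b-x)^{q-1} \quad \text{for } a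 < x < b,$$ and $f_{p,q}(x)=0$ otherwise, where $B(p,q) = \Gamma(p)\Gamma(q)/\Gamma(p+q)$. The same interval $[a,b]$ is used for all the beta distributions in the statement. *)

theory Defs
  imports "HOL-Probability.Probability"
begin

definition order_statistic :: "nat \<Rightarrow> (nat \<Rightarrow> real) \<Rightarrow> nat \<Rightarrow> real" where
  "order_statistic n u j =
     (if j = 0 then 0 else if j = n then 1 else sort (map u [1..<n]) ! (j - 1))"
  (* The sample is u 1, ..., u (n - 1). List positions start at 0, so the j-th smallest sample
     value, 1 \<le> j \<le> n - 1, is at position j - 1. The values 0 at j = 0 and 1 at j = n are the
     conventions for a sample from (0,1). *)

definition random_weight :: "nat \<Rightarrow> (nat \<Rightarrow> nat) \<Rightarrow> (nat \<Rightarrow> real) \<Rightarrow> nat \<Rightarrow> real" where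
  "random_weight n N u j = order_statistic n u (N j) - order_statistic n u (N (j - 1))"

definition beta_density :: "real \<Rightarrow> real \<Rightarrow> real \<Rightarrow> real \<Rightarrow> real \<Rightarrow> real" where
  "beta_density a b p q x =
     (if a < x \<and> x < b
      then (x - a) powr (p - 1) * (b - x) powr (q - 1) / (Beta p q * (b - a) powr (p + q - 1))
      else 0)"

end

(* By affine invariance take [a, b] = [0, 1]; both laws are then determined by their moments.
   Given X = x, S is a linear combination of the n uniform spacings in which the value x_j is
   repeated r_j times, so by the Hermite-Genocchi formula its m-th moment is, up to the factor
   m! (n - 1)! / (n - 1 + m)!, the coefficient of t^m in the product of the (1 - x_j t)^(-r_j).
   Averaging over the X_j replaces (1 - x_j t)^(-r_j) by a series G_(r_j)(t), and for the symmetric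
   beta laws with parameter r + 1/2 this series is C(t/4)^(2 r), C the Catalan generating function.
   Hence the product of the G_(r_j) is G_n, which is the same moment series for the claimed law. *)
theory Submission
  imports Defs
begin

text \<open>The halves in the parameters come from the duplication identity for rising factorials,
  (r)_i (r + 1/2)_i = (2 r)_(2 i) / 4^i. The i-th coefficient of (1 - x t)^(-r) is (r)_i / i! times
  x^i, and the i-th moment of the symmetric law with parameter r + 1/2 is (r + 1/2)_i / (2 r + 1)_i,
  so the averaged coefficient is (2 r)_(2 i) / (4^i i! (2 r + 1)_i), a ballot number over 4^i. This
  is also the origin of the argument t/4.

  The formula for fixed values rests on removing the largest sample point. What remains is a sample
  on a shorter interval, indexed by a set that lacks an arbitrary element, hence order statistics
  with a general index set and a variable right end. Values in [0, 1] keep all powers nonnegative,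
  so moments are computed as nonnegative integrals, where sums and integrals exchange freely. The
  prefactor of the m-th moment depends only on n and m and is the reciprocal of the binomial
  coefficient in the series for n, so it cancels at the end.\<close>

subsection \<open>Powers of the Catalan series\<close>

text \<open>The coefficient \<open>p / (p + 2 i) * ((p + 2 i) choose i)\<close> of \<open>t\<^sup>i\<close> in the \<open>p\<close>-th power of the
  Catalan series; \<open>i = 0\<close> is separate because the closed form gives 0 rather than 1 at \<open>p = 0\<close>.\<close>
definition ballot :: "nat \<Rightarrow> nat \<Rightarrow> real" where
  "ballot p i = (if i = 0 then 1 else real p * fact (p + 2 * i - 1) / (fact i * fact (p + i)))"

lemma ballot_0: "ballot p 0 = 1"
  by (simp add: ballot_def)

text \<open>Coefficient form of C = 1 + t C^2 multiplied by C^p. Over the common denominator (i +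
  1)! (p + i + 2)! all three terms share the factor (p + 2 i + 1)!, and a polynomial identity in p
  and i remains. The case \<open>i = 0\<close> is separate because \<open>ballot (p + 2) 0\<close>
  falls into the other branch of the definition.\<close>

lemma ballot_Suc: "ballot (Suc p) (Suc i) = ballot p (Suc i) + ballot (p + 2) i"
proof (cases "i = 0")
  case True
  then show ?thesis by (simp add: ballot_def divide_simps)
next
  case False
  have e1: "fact (Suc p + 2 * Suc i - 1) = (real p + 2 * real i + 2) * fact (p + 2 * i + 1)"
    using fact_Suc[where 'a = real, of "p + 2 * i + 1"] by (simp add: algebra_simps)
  have e2: "fact (Suc p + Suc i) = (real p + real i + 2) * fact (p + i + 1)"
    using fact_Suc[where 'a = real, of "p + i + 1"] by (simp add: algebra_simps)
  have e3: "fact (Suc i) = (real i + 1) * fact i"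
    by (simp add: algebra_simps)
  define F G H :: real where "F = fact (p + 2 * i + 1)" and "G = fact (p + i + 1)" and "H = fact i"
  have nz: "G \<noteq> 0" "H \<noteq> 0" "real p + real i + 2 \<noteq> 0" "real i + 1 \<noteq> 0"
    by (simp_all add: G_def H_def)
  have "ballot (Suc p) (Suc i) = (real p + 1) * ((real p + 2 * real i + 2) * F)
      / (((real i + 1) * H) * ((real p + real i + 2) * G))"
    unfolding ballot_def F_def G_def H_def e1 e2 e3 by (simp add: add.commute)
  moreover have "ballot p (Suc i) = (real p * (real p + real i + 2) * F) / (((real i + 1) * H)
      * ((real p + real i + 2) * G))"
    using nz(3) unfolding ballot_def F_def G_def H_def e3 by simp
  moreover have "ballot (p + 2) i = ((real p + 2) * (real i + 1) * F) / (((real i + 1) * H)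
      * ((real p + real i + 2) * G))"
    using False e2 nz(4) unfolding ballot_def F_def G_def H_def by (simp add: add.commute)
  moreover have "(real p + 1) * ((real p + 2 * real i + 2) * F) =
      real p * (real p + real i + 2) * F + (real p + 2) * (real i + 1) * F"
    by algebra
  ultimately show ?thesis
    by (simp only: add_divide_distrib)
qed

definition ballot_fps :: "nat \<Rightarrow> real fps" where
  "ballot_fps p = Abs_fps (ballot p)"

lemma ballot_fps_0: "ballot_fps 0 = 1"
  by (rule fps_ext) (simp add: ballot_fps_def ballot_def)

lemma ballot_fps_Suc: "ballot_fps (Suc p) = ballot_fps p + fps_X * ballot_fps (p + 2)"
proof (rule fps_ext)
  fix i show "fps_nth (ballot_fps (Suc p)) i = fps_nth (ballot_fps p + fps_X * ballot_fps (p + 2)) i"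
    by (cases i) (simp_all add: ballot_fps_def ballot_0 ballot_Suc del: add_2_eq_Suc' add_2_eq_Suc)
qed

text \<open>Double induction, on the coefficient and then on \<open>p\<close>, from \<open>C\<^sup>p\<^sup>+\<^sup>1 = C\<^sup>p + t C\<^sup>p\<^sup>+\<^sup>2\<close>.\<close>
lemma ballot_fps_add: "ballot_fps (p + q) = ballot_fps p * ballot_fps q"
proof -
  have "fps_nth (ballot_fps p * ballot_fps q) m = fps_nth (ballot_fps (p + q)) m" for m
  proof (induction m arbitrary: p)
    case 0
    show ?case by (simp add: ballot_fps_def ballot_0)
  next
    case (Suc m)
    \<comment> \<open>The factor \<open>fps_X\<close> lowers the coefficient index but raises the
      exponent to \<open>p + 2\<close>, so the outer hypothesis is needed at an exponent other than
      the current one.\<close>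
    note step = Suc.IH
    show ?case
    proof (induction p)
      case 0
      show ?case by (simp add: ballot_fps_0)
    next
      case (Suc p)
      have "fps_nth (ballot_fps (Suc p) * ballot_fps q) (Suc m) =
          fps_nth (ballot_fps p * ballot_fps q) (Suc m)
          + fps_nth (fps_X * (ballot_fps (p + 2) * ballot_fps q)) (Suc m)"
        by (simp only: ballot_fps_Suc ring_distribs mult.assoc fps_add_nth)
      also have "\<dots> = fps_nth (ballot_fps (p + q)) (Suc m) + fps_nth (ballot_fps (p + q + 2)) m"
        using Suc.IH step[of "p + 2"] by (simp add: add_ac)
      also have "\<dots> = fps_nth (ballot_fps (Suc (p + q))) (Suc m)"
        by (subst ballot_fps_Suc) simp
      finally show ?case by simp
    qed
  qed
  then show ?thesis by (simp add: fps_eq_iff)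
qed

lemma ballot_fps_sum: "ballot_fps (\<Sum>j\<in>J. p j) = (\<Prod>j\<in>J. ballot_fps (p j))"
  by (induction J rule: infinite_finite_induct) (simp_all add: ballot_fps_0 ballot_fps_add)

section \<open>Moments of the symmetric beta laws on [0, 1]\<close>

definition sym_beta_moment :: "nat \<Rightarrow> nat \<Rightarrow> real" where
  "sym_beta_moment r i = Beta (real r + 1/2 + real i) (real r + 1/2) / Beta (real r + 1/2) (real r
      + 1/2)"

text \<open>Both sides have the same ratio of consecutive terms. On the left it is (r + i)(r + i +
  1/2) / ((i + 1)(2 r + i + 1)); doubling the two numerator factors yields the consecutive integers
  2 r + 2 i and 2 r + 2 i + 1 by which the factorial in \<open>ballot\<close> grows, at the cost of
  a factor 4.\<close>

lemma choose_times_moment: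
  assumes "0 < r"
  shows "real ((r - 1 + i) choose i) * sym_beta_moment r i = ballot (2 * r) i / 4 ^ i"
proof (induction i)
  case 0
  have "Beta (real r + 1/2) (real r + 1/2) > 0"
    unfolding Beta_def by (intro mult_pos_pos divide_pos_pos Gamma_real_pos) auto
  then show ?case by (simp add: sym_beta_moment_def ballot_0)
next
  case (Suc i)
  have m: "sym_beta_moment r (Suc i) * (2 * real r + 1 + i) = sym_beta_moment r i * (real r + 1/2 + i)"
  proof -
    have "(real r + 1/2 + i + (real r + 1/2)) * Beta (real r + 1/2 + i + 1) (real r + 1/2)
        = (real r + 1/2 + i) * Beta (real r + 1/2 + i) (real r + 1/2)"
      by (rule Beta_plus1_left) (auto elim!: nonpos_Ints_cases)
    then show ?thesis
      by (simp add: sym_beta_moment_def divide_simps) (simp add: algebra_simps)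
  qed
  have c: "real ((r - 1 + Suc i) choose Suc i) * (real i + 1)
      = (real r + i) * real ((r - 1 + i) choose i)"
  proof -
    have "Suc i * (Suc (r - 1 + i) choose Suc i) = Suc (r - 1 + i) * ((r - 1 + i) choose i)"
      by (rule Suc_times_binomial)
    then have "real (Suc i) * real (Suc (r - 1 + i) choose Suc i)
        = real (Suc (r - 1 + i)) * real ((r - 1 + i) choose i)"
      by (metis of_nat_mult)
    then show ?thesis using assms by (simp add: algebra_simps of_nat_diff)
  qed
  have b: "ballot (2 * r) (Suc i) * ((real i + 1) * (2 * real r + real i + 1))
      = ballot (2 * r) i * ((2 * real r + 2 * real i + 1) * (2 * real r + 2 * real i))"
  proof -
    \<comment> \<open>For positive \<open>r\<close> the closed form also gives 1 at index 0, so the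
      recurrence below needs no case split.\<close>
    have bb: "ballot (2 * r) j = 2 * real r * fact (2 * r + 2 * j - 1)
        / (fact j * fact (2 * r + j))" for j
    proof (cases "j = 0")
      case True
      have "fact (2 * r) = (2 * real r) * fact (2 * r - 1)"
        using assms by (subst fact_reduce) auto
      with True assms show ?thesis by (simp add: ballot_def)
    qed (simp add: ballot_def)
    obtain q where q: "2 * r + 2 * i = Suc q" using assms by (cases "2 * r + 2 * i") auto
    have qq: "2 * real r + 2 * real i = real q + 1" using q by linarith
    have q2: "2 * r + 2 * Suc i - 1 = Suc (Suc q)" "2 * r + 2 * i - 1 = q" using q by auto
    have f1: "fact (2 * r + 2 * Suc i - 1)
        = (2 * real r + 2 * real i + 1) * ((2 * real r + 2 * real i) * fact (2 * r + 2 * i - 1))"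
      unfolding q2 qq by (simp add: algebra_simps)
    have f2: "fact (2 * r + Suc i) = (2 * real r + real i + 1) * fact (2 * r + i)"
      by (simp add: algebra_simps)
    have f3: "fact (Suc i) = (real i + 1) * fact i" by (simp add: algebra_simps)
    have "2 * real r + real i + 1 \<noteq> 0" "real i + 1 \<noteq> 0" by auto
    then show ?thesis unfolding bb f1 f2 f3
      by (simp add: divide_simps)
  qed
  have nz: "(real i + 1) * (2 * real r + 1 + real i) \<noteq> 0" by auto
  have "real ((r - 1 + Suc i) choose Suc i) * sym_beta_moment r (Suc i) * ((real i + 1)
      * (2 * real r + 1 + real i))
     = (real ((r - 1 + Suc i) choose Suc i) * (real i + 1)) * (sym_beta_moment r (Suc i)
         * (2 * real r + 1 + real i))"
    by (simp only: ac_simps)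
  also have "\<dots> = (real r + i) * (real r + 1/2 + i)
      * (real ((r - 1 + i) choose i) * sym_beta_moment r i)"
    unfolding m c by (simp only: ac_simps)
  also have "\<dots> = (real r + i) * (real r + 1/2 + i) * (ballot (2 * r) i / 4 ^ i)"
    unfolding Suc.IH ..
  also have "\<dots> = ballot (2 * r) i * ((2 * real r + 2 * real i + 1)
      * (2 * real r + 2 * real i)) / 4 ^ Suc i"
    by (simp add: field_simps)
  also have "\<dots> = ballot (2 * r) (Suc i) / 4 ^ Suc i * ((real i + 1) * (2 * real r + 1 + real i))"
    unfolding b[symmetric] by (simp add: add_ac)
  finally show ?case using nz by (metis mult_right_cancel)
qed

subsection \<open>Moments\<close>

lemma nn_integral_Beta:
  fixes p q :: real
  assumes "0 < p" "0 < q"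
  shows "(\<integral>\<^sup>+x. indicator {0<..<1} x * ennreal (x powr (p - 1) * (1 - x) powr (q - 1)) \<partial>lborel)
      = ennreal (Beta p q)"
proof -
  have "((\<lambda>x. x powr (p - 1) * (1 - x) powr (q - 1)) has_integral Beta p q) {0<..<1}"
    using has_integral_Beta_real[OF assms] by (simp add: has_integral_Icc_iff_Ioo)
  from nn_integral_has_integral_lebesgue[OF _ this] show ?thesis
    by (simp add: ennreal_mult' ennreal_indicator)
qed

text \<open>Scaling by \<open>s\<close> reduces this to the Beta integral. It is the integral over
  the value of the largest sample point in the inductive step of the Hermite-Genocchi
  formula.\<close>

lemma nn_integral_Beta_nat:
  fixes s :: real
  assumes "0 < s"
  shows "(\<integral>\<^sup>+x. indicator {0<..<s} x * ennreal (x ^ i * (s - x) ^ j) \<partial>lborel)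
       = ennreal (fact i * fact j / fact (i + j + 1) * s ^ (i + j + 1))"
proof -
  have B: "Beta (real i + 1) (real j + 1) = fact i * fact j / fact (i + j + 1)"
    using Gamma_fact[of i, where 'a = real] Gamma_fact[of j, where 'a = real]
      Gamma_fact[of "i + j + 1", where 'a = real]
    by (simp add: Beta_def add_ac)
  have "(\<integral>\<^sup>+x. indicator {0<..<s} x * ennreal (x ^ i * (s - x) ^ j) \<partial>lborel)
      = ennreal s * (\<integral>\<^sup>+x. indicator {0<..<s} (s * x) * ennreal ((s * x) ^ i * (s - s * x) ^ j) \<partial>lborel)"
    using assms by (subst nn_integral_real_affine[where c = s and t = 0]) auto
  also have "\<dots> = ennreal s * (\<integral>\<^sup>+x. ennreal (s ^ (i + j)) * (indicator {0<..<1} x *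
                      ennreal (x powr ((real i + 1) - 1) * (1 - x) powr ((real j + 1) - 1))) \<partial>lborel)"
  proof (rule arg_cong2[where f = "(*)", OF refl nn_integral_cong])
    fix x :: real
    have "(s * x) ^ i * (s - s * x) ^ j = s ^ (i + j) * (x ^ i * (1 - x) ^ j)"
    proof -
      have "s - s * x = s * (1 - x)" by algebra
      then show ?thesis by (simp only: power_mult_distrib power_add) (simp add: mult_ac)
    qed
    moreover have "s * x < s \<longleftrightarrow> x < 1" "0 < s * x \<longleftrightarrow> 0 < x"
      using assms by (auto simp: zero_less_mult_iff)
    ultimately show "indicator {0<..<s} (s * x) * ennreal ((s * x) ^ i * (s - s * x) ^ j) =
        ennreal (s ^ (i + j)) * (indicator {0<..<1} x * ennreal (x powr ((real i + 1) - 1)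
            * (1 - x) powr ((real j + 1) - 1)))"
      using assms by (auto simp: indicator_def powr_realpow ennreal_mult')
  qed
  also have "\<dots> = ennreal s * (ennreal (s ^ (i + j)) * ennreal (Beta (real i + 1) (real j + 1)))"
    using nn_integral_Beta[of "real i + 1" "real j + 1"] by (subst nn_integral_cmult) simp_all
  also have "\<dots> = ennreal (fact i * fact j / fact (i + j + 1) * s ^ (i + j + 1))"
    unfolding B using assms by (simp add: ennreal_mult'[symmetric] mult_ac del: fact_Suc)
  finally show ?thesis .
qed

lemma beta_density_nonneg: "0 \<le> beta_density a b p q x" if "0 < p" "0 < q" "a < b"
  using that unfolding beta_density_def Beta_def
  by (auto intro!: divide_nonneg_nonneg mult_nonneg_nonneg less_imp_le[OF Gamma_real_pos])

lemma borel_measurable_beta_density [measurable]: "beta_density a b p q \<in> borel_measurable borel"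
  unfolding beta_density_def by measurable

lemma nn_integral_beta_density_power:
  fixes p q :: real
  assumes "0 < p" "0 < q"
  shows "(\<integral>\<^sup>+x. ennreal (beta_density 0 1 p q x) * ennreal (x ^ m) \<partial>lborel)
      = ennreal (Beta (p + m) q / Beta p q)"
proof -
  have pos: "Beta p q > 0"
    using assms unfolding Beta_def by (intro mult_pos_pos divide_pos_pos Gamma_real_pos) auto
  have "(\<integral>\<^sup>+x. ennreal (beta_density 0 1 p q x) * ennreal (x ^ m) \<partial>lborel)
      = (\<integral>\<^sup>+x. ennreal (1 / Beta p q) * (indicator {0<..<1} x * ennreal (x powr ((p + m) - 1)
          * (1 - x) powr (q - 1))) \<partial>lborel)"
  proof (rule nn_integral_cong)
    fix x :: real
    have "x powr (p + m - 1) = x powr (p - 1) * x ^ m" if "0 < x"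
      using that by (simp add: powr_realpow[symmetric] powr_add[symmetric] algebra_simps)
    then show "ennreal (beta_density 0 1 p q x) * ennreal (x ^ m) =
      ennreal (1 / Beta p q) * (indicator {0<..<1} x * ennreal (x powr ((p + m) - 1)
          * (1 - x) powr (q - 1)))"
      using pos by (auto simp: beta_density_def ennreal_mult'[symmetric] ennreal_mult''[symmetric] mult_ac split: split_indicator)
  qed
  also have "\<dots> = ennreal (1 / Beta p q) * ennreal (Beta (p + m) q)"
    using assms nn_integral_Beta[of "p + m" q] by (subst nn_integral_cmult) simp_all
  also have "\<dots> = ennreal (Beta (p + m) q / Beta p q)"
    using pos by (simp add: ennreal_mult'[symmetric])
  finally show ?thesis .
qed

text \<open>Of the exponent p + q - 1 of b - a, the parts p - 1 and q - 1 are absorbed by the two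
  powers, and the remaining 1 is the Jacobian. The identity serves twice: to move the given
  variables to [0, 1] and to move the average back to [a, b].\<close>

lemma beta_density_affine:
  assumes "a < b"
  shows "beta_density a b p q (a + (b - a) * x) = beta_density 0 1 p q x / (b - a)"
proof -
  have e: "b - (a + (b - a) * x) = (b - a) * (1 - x)" by algebra
  have i: "a + (b - a) * x < b \<longleftrightarrow> x < 1" "0 < (b - a) * x \<longleftrightarrow> 0 < x"
  proof -
    have "a + (b - a) * x < b \<longleftrightarrow> 0 < (b - a) * (1 - x)" by (simp add: e[symmetric])
    also have "\<dots> \<longleftrightarrow> x < 1" using assms by (auto simp: zero_less_mult_iff)
    finally show "a + (b - a) * x < b \<longleftrightarrow> x < 1" .
  qed (use assms in \<open>auto simp: zero_less_mult_iff\<close>)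
  show ?thesis
  proof (cases "0 < x \<and> x < 1")
    case True
    have "(b - a) powr (p + q - 1) = (b - a) powr (p - 1) * (b - a) powr (q - 1) * (b - a)"
      using assms by (simp add: powr_add[symmetric] powr_mult_base mult.commute[of _ "b - a"])
    then show ?thesis
      using True assms i by (simp add: beta_density_def e powr_mult divide_simps)
  qed (auto simp: beta_density_def i)
qed

text \<open>The Taylor remainder of the characteristic function after the terms below order n is at
  most 2 |t|^n / n! times the n-th absolute moment. That moment is at most 1 on [0, 1], so the bound
  tends to 0.\<close>

lemma (in prob_space) char_eq_limit_of_moments:
  fixes X :: "'a \<Rightarrow> real"
  assumes [measurable]: "random_variable borel X" and X: "AE x in M. 0 \<le> X x \<and> X x \<le> 1"
  shows "(\<lambda>n. \<Sum>k\<le>n. ((\<i> * t) ^ k / fact k) * expectation (\<lambda>x. X x ^ k)) \<longlonglongrightarrow> char (distr M borel X) t"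
proof -
  have le1: "AE x in M. norm (X x ^ k) \<le> 1" "AE x in M. \<bar>X x\<bar> ^ k \<le> 1" for k
    using X by (eventually_elim, simp add: power_le_one)+
  have int: "integrable M (\<lambda>x. X x ^ k)" for k
    by (rule integrable_const_bound[OF le1(1)]) simp
  have bound: "norm (char (distr M borel X) t - (\<Sum>k\<le>n. ((\<i> * t) ^ k / fact k)
      * expectation (\<lambda>x. X x ^ k)))
       \<le> 2 * (\<bar>t\<bar> ^ n / fact n)" for n
  proof -
    have "expectation (\<lambda>x. \<bar>X x\<bar> ^ n) \<le> 1"
      by (rule integral_le_const) (use le1 integrable_abs[OF int[of n]] in \<open>simp_all add: power_abs\<close>)
    then have "(2 * \<bar>t\<bar> ^ n / fact n) * expectation (\<lambda>x. \<bar>X x\<bar> ^ n) \<le> (2 * \<bar>t\<bar> ^ n / fact n) * 1"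
      by (intro mult_left_mono) auto
    then show ?thesis
      using char_approx1'[OF int assms(1) refl, of t n] by simp
  qed
  have lim: "(\<lambda>n. 2 * (\<bar>t\<bar> ^ n / fact n)) \<longlonglongrightarrow> 0"
    using tendsto_mult_right_zero[OF summable_LIMSEQ_zero[OF summable_exp[of "\<bar>t\<bar>"]], of 2]
    by (simp add: field_simps)
  have "(\<lambda>n. char (distr M borel X) t - (\<Sum>k\<le>n. ((\<i> * t) ^ k / fact k) * expectation (\<lambda>x. X x ^ k))) \<longlonglongrightarrow> 0"
    by (rule Lim_null_comparison[OF _ lim]) (use bound in auto)
  then show ?thesis
    by (rule Lim_transform2[OF tendsto_const])
qed

text \<open>Equal moments give equal characteristic functions as limits of the same sums, and Levy's
  theorem applies. Moments enter as nonnegative integrals, the form in which they are computed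
  below.\<close>

lemma distr_eq_of_moments:
  fixes X :: "'a \<Rightarrow> real" and Y :: "'b \<Rightarrow> real"
  assumes "prob_space M" "prob_space N"
    and [measurable]: "X \<in> borel_measurable M" "Y \<in> borel_measurable N"
    and X: "AE x in M. 0 \<le> X x \<and> X x \<le> 1" and Y: "AE y in N. 0 \<le> Y y \<and> Y y \<le> 1"
    and eq: "\<And>m. (\<integral>\<^sup>+x. ennreal (X x ^ m) \<partial>M) = (\<integral>\<^sup>+y. ennreal (Y y ^ m) \<partial>N)"
  shows "distr M borel X = distr N borel Y"
proof (rule Levy_uniqueness)
  interpret M: prob_space M by fact
  interpret N: prob_space N by fact
  show "real_distribution (distr M borel X)" "real_distribution (distr N borel Y)"
    by auto
  have "M.expectation (\<lambda>x. X x ^ k) = N.expectation (\<lambda>y. Y y ^ k)" for k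
  proof -
    have "M.expectation (\<lambda>x. X x ^ k) = enn2real (\<integral>\<^sup>+x. ennreal (X x ^ k) \<partial>M)"
      by (rule integral_eq_nn_integral) (use X in \<open>simp, eventually_elim, simp\<close>)
    also have "\<dots> = N.expectation (\<lambda>y. Y y ^ k)"
      unfolding eq by (rule integral_eq_nn_integral[symmetric]) (use Y in \<open>simp, eventually_elim, simp\<close>)
    finally show ?thesis .
  qed
  then show "char (distr M borel X) = char (distr N borel Y)"
    using LIMSEQ_unique[OF M.char_eq_limit_of_moments[OF _ X] ] N.char_eq_limit_of_moments[OF _ Y]
    by (intro ext) (auto)
qed

subsection \<open>Spacings\<close>

text \<open>The right end \<open>s\<close> is a parameter and stands for every order statistic
  beyond the last sample point. Both it and the index set change when the largest point is
  removed.\<close>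

definition order_stat_on :: "'i set \<Rightarrow> ('i \<Rightarrow> real) \<Rightarrow> real \<Rightarrow> nat \<Rightarrow> real" where
  "order_stat_on I u s j =
     (if j = 0 then 0 else if card I < j then s
      else sorted_list_of_multiset (image_mset u (mset_set I)) ! (j - 1))"

lemma order_stat_on_cong: "(\<And>i. i \<in> I \<Longrightarrow> u i = v i) \<Longrightarrow> order_stat_on I u s j = order_stat_on I v s j"
proof -
  assume "\<And>i. i \<in> I \<Longrightarrow> u i = v i"
  then have "image_mset u (mset_set I) = image_mset v (mset_set I)"
    by (cases "finite I") (auto intro: image_mset_cong)
  then show ?thesis by (simp add: order_stat_on_def)
qed

text \<open>The sorted list for \<open>I\<close> is the one for \<open>I - {i}\<close> followed by
  \<open>u i\<close>. At \<open>j = card I\<close> the right-hand side is past its sample and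
  returns its end point, which is again \<open>u i\<close>.\<close>

lemma order_stat_on_remove_Max:
  assumes "finite I" "i \<in> I" and max: "\<And>j. j \<in> I - {i} \<Longrightarrow> u j \<le> u i" and j: "j \<le> card I"
  shows "order_stat_on I u s j = order_stat_on (I - {i}) u (u i) j"
proof -
  let ?L = "\<lambda>J. sorted_list_of_multiset (image_mset u (mset_set J))"
  have *: "mset (?L J) = image_mset u (mset_set J)" "sorted (?L J)" for J
    by simp_all
  have "\<forall>x\<in>set (?L (I - {i})). x \<le> u i"
  proof
    fix x assume "x \<in> set (?L (I - {i}))"
    then have "x \<in># image_mset u (mset_set (I - {i}))" by simp
    then show "x \<le> u i" using max assms(1) by auto
  qed
  then have "sorted (?L (I - {i}) @ [u i])"
    using *(2) by (simp add: sorted_append)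
  moreover have "mset (?L (I - {i}) @ [u i]) = image_mset u (mset_set I)"
    using assms(1,2) by (simp add: mset_set.remove)
  ultimately have L: "?L I = ?L (I - {i}) @ [u i]"
    by (metis sorted_list_of_multiset_mset sorted_sort_id)
  have len: "length (?L (I - {i})) = card I - 1"
    using assms(1,2) by (metis *(1) size_mset size_image_mset size_mset_set card_Diff_singleton)
  have "card I \<noteq> 0" using assms(1,2) by auto
  then show ?thesis
    using j assms(1,2) by (auto simp: order_stat_on_def L len nth_append card_Diff_singleton)
qed

text \<open>In a sorted list the entries at most \<open>a\<close> form an initial segment, so
  position \<open>i\<close> lies in it exactly when the segment is longer than
  \<open>i\<close>.\<close>

lemma sorted_nth_le_iff:
  assumes "sorted (xs :: 'a :: linorder list)" "i < length xs"
  shows "xs ! i \<le> a \<longleftrightarrow> i < length (filter (\<lambda>x. x \<le> a) xs)"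
  using assms
proof (induction xs arbitrary: i)
  case (Cons x xs)
  show ?case
  proof (cases "x \<le> a")
    case True
    with Cons show ?thesis by (cases i) auto
  next
    case False
    then have "\<forall>y\<in>set (x # xs). \<not> y \<le> a" using Cons.prems by auto
    then have "filter (\<lambda>x. x \<le> a) (x # xs) = []" "\<not> (x # xs) ! i \<le> a"
      using Cons.prems(2) nth_mem[of i "x # xs"] by (auto simp del: nth_Cons_0 simp: filter_empty_conv)
    then show ?thesis by simp
  qed
qed simp

text \<open>Counting the sample points up to \<open>a\<close> replaces sorting by a finite sum of
  indicators, from which measurability of the order statistics is immediate.\<close>

lemma order_stat_on_le_iff:
  assumes "finite I" "1 \<le> j" "j \<le> card I"
  shows "order_stat_on I u s j \<le> a \<longleftrightarrow> j \<le> (\<Sum>i\<in>I. if u i \<le> a then 1 else 0)"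
proof -
  let ?L = "sorted_list_of_multiset (image_mset u (mset_set I))"
  have "length (filter (\<lambda>x. x \<le> a) ?L) = size (filter_mset (\<lambda>x. x \<le> a) (image_mset u (mset_set I)))"
    by (metis mset_filter mset_sorted_list_of_multiset size_mset)
  also have "\<dots> = card {i\<in>I. u i \<le> a}"
    using assms(1) by (simp add: filter_mset_image_mset)
  also have "\<dots> = (\<Sum>i\<in>I. if u i \<le> a then 1 else 0)"
    using assms(1) by (simp add: sum.If_cases Int_def)
  finally have f: "length (filter (\<lambda>x. x \<le> a) ?L) = (\<Sum>i\<in>I. if u i \<le> a then 1 else 0)" .
  have "length ?L = card I"
    by (metis mset_sorted_list_of_multiset size_mset size_image_mset size_mset_set)
  then show ?thesis
    using sorted_nth_le_iff[of ?L "j - 1" a] assms unfolding f by (auto simp: order_stat_on_def)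
qed

lemma borel_measurable_order_stat_on:
  assumes "finite I" and [measurable]: "\<And>i. i \<in> I \<Longrightarrow> (\<lambda>\<omega>. u \<omega> i) \<in> borel_measurable N"
  shows "(\<lambda>\<omega>. order_stat_on I (u \<omega>) s j) \<in> borel_measurable N"
proof (cases "1 \<le> j \<and> j \<le> card I")
  case True
  then have "{\<omega> \<in> space N. order_stat_on I (u \<omega>) s j \<le> a} =
      {\<omega> \<in> space N. j \<le> (\<Sum>i\<in>I. if u \<omega> i \<le> a then 1 else (0::nat))}" for a
    using order_stat_on_le_iff[OF assms(1)] by simp
  moreover have "{\<omega> \<in> space N. j \<le> (\<Sum>i\<in>I. if u \<omega> i \<le> a then 1 else (0::nat))} \<in> sets N" for a
    by measurable
  ultimately show ?thesis by (simp add: borel_measurable_iff_le)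
qed (auto simp: order_stat_on_def not_le)

text \<open>The weights are indexed from 0: \<open>y i\<close> multiplies the spacing between the order statistics
  \<open>i\<close> and \<open>i + 1\<close>.\<close>
definition spacing_sum :: "(nat \<Rightarrow> real) \<Rightarrow> 'i set \<Rightarrow> ('i \<Rightarrow> real) \<Rightarrow> real \<Rightarrow> real" where
  "spacing_sum y I u s = (\<Sum>i<Suc (card I). y i * (order_stat_on I u s (Suc i) - order_stat_on I u s i))"

lemma spacing_sum_cong: "(\<And>i. i \<in> I \<Longrightarrow> u i = v i) \<Longrightarrow> spacing_sum y I u s = spacing_sum y I v s"
  unfolding spacing_sum_def by (simp cong: order_stat_on_cong)

lemma spacing_sum_empty: "spacing_sum y {} u s = y 0 * s"
  by (simp add: spacing_sum_def order_stat_on_def)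

lemma borel_measurable_spacing_sum:
  assumes "finite I" "\<And>i. i \<in> I \<Longrightarrow> (\<lambda>\<omega>. u \<omega> i) \<in> borel_measurable N"
  shows "(\<lambda>\<omega>. spacing_sum y I (u \<omega>) s) \<in> borel_measurable N"
  unfolding spacing_sum_def
  by (intro borel_measurable_sum borel_measurable_times borel_measurable_diff borel_measurable_const
        borel_measurable_order_stat_on assms)

text \<open>The recursion behind every induction on spacings: the largest point cuts off the last
  spacing and becomes the right end for the other points, whose weights keep their indices.\<close>

lemma spacing_sum_remove_Max:
  assumes "finite I" "i \<in> I" and max: "\<And>j. j \<in> I - {i} \<Longrightarrow> u j \<le> u i"
  shows "spacing_sum y I u s = spacing_sum y (I - {i}) u (u i) + y (card I) * (s - u i)"
proof -
  have c: "Suc (card (I - {i})) = card I"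
    using assms(1,2) by (metis card_Suc_Diff1)
  have R: "order_stat_on I u s j = order_stat_on (I - {i}) u (u i) j" if "j \<le> card I" for j
    using order_stat_on_remove_Max[OF assms(1,2) _ that] max by blast
  have "order_stat_on I u s (Suc (card I)) = s" by (simp add: order_stat_on_def)
  moreover have "order_stat_on I u s (card I) = u i"
    using R[OF order_refl] c by (simp add: order_stat_on_def)
  ultimately show ?thesis
    unfolding spacing_sum_def c by (simp add: R)
qed

lemma ex_Max_image:
  fixes u :: "'i \<Rightarrow> 'a :: linorder"
  assumes "finite I" "I \<noteq> {}"
  shows "\<exists>i\<in>I. \<forall>j\<in>I. u j \<le> u i"
proof -
  have "Max (u ` I) \<in> u ` I" using assms by (intro Max_in) auto
  then obtain i where "i \<in> I" "u i = Max (u ` I)" by auto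
  then show ?thesis using assms(1) by (metis Max_ge finite_imageI imageI)
qed

lemma spacing_sum_nonneg:
  assumes "finite I" "\<And>i. 0 \<le> y i" "\<And>i. i \<in> I \<Longrightarrow> 0 \<le> u i \<and> u i \<le> s" "0 \<le> s"
  shows "0 \<le> spacing_sum y I u s"
  using assms
proof (induction "card I" arbitrary: I s)
  case 0
  then show ?case by (simp add: spacing_sum_empty)
next
  case (Suc d)
  then have "I \<noteq> {}" by auto
  then obtain i where i: "i \<in> I" "\<And>j. j \<in> I \<Longrightarrow> u j \<le> u i"
    using ex_Max_image[OF Suc.prems(1)] by blast
  have "0 \<le> spacing_sum y (I - {i}) u (u i)"
    by (rule Suc.hyps(1)) (use Suc i in auto)
  moreover have "0 \<le> y (card I) * (s - u i)"
    using Suc.prems i(1) by simp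
  ultimately show ?case
    using spacing_sum_remove_Max[of I i u y s] i Suc.prems(1) by simp
qed

text \<open>The series with coefficients \<open>y i ^ l\<close> is 1 / (1 - y_i t). Defining the
  polynomial by its generating function makes repeated variables appear directly as powers of such a
  factor.\<close>

definition complete_homogeneous :: "(nat \<Rightarrow> real) \<Rightarrow> nat \<Rightarrow> nat \<Rightarrow> real" where
  "complete_homogeneous y d m = fps_nth (\<Prod>i<d. Abs_fps (\<lambda>l. y i ^ l)) m"

lemma complete_homogeneous_1: "complete_homogeneous y (Suc 0) m = y 0 ^ m"
  by (simp add: complete_homogeneous_def)

lemma complete_homogeneous_Suc:
  "complete_homogeneous y (Suc d) m = (\<Sum>l\<le>m. complete_homogeneous y d l * y d ^ (m - l))"
  by (simp add: complete_homogeneous_def fps_mult_nth atLeast0AtMost)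

lemma complete_homogeneous_nonneg: "(\<And>i. 0 \<le> y i) \<Longrightarrow> 0 \<le> complete_homogeneous y d m"
proof (induction d arbitrary: m)
  case 0
  show ?case by (simp add: complete_homogeneous_def)
next
  case (Suc d)
  then show ?case by (auto simp: complete_homogeneous_Suc intro!: sum_nonneg)
qed

section \<open>Uniform samples and the absence of ties\<close>

abbreviation unif01 :: "real measure" where
  "unif01 \<equiv> density lborel (indicator {0<..<1})"

lemma prob_space_unif01: "prob_space unif01"
  by (rule prob_spaceI) (simp add: emeasure_density)

text \<open>With the other coordinates fixed, a tie confines coordinate \<open>i\<close> to the
  single point \<open>x j\<close>, a null set; integrating over the other coordinates keeps it
  null.\<close>

lemma AE_PiM_unif01_distinct:
  assumes "finite I" "i \<in> I" "j \<in> I" "i \<noteq> j"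
  shows "AE u in PiM I (\<lambda>_. unif01). u i \<noteq> u j"
proof -
  interpret unif: prob_space unif01 by (rule prob_space_unif01)
  interpret product_sigma_finite "\<lambda>_. unif01" by unfold_locales
  define J where "J = I - {i}"
  have J: "finite J" "i \<notin> J" "I = insert i J" "j \<in> J" using assms by (auto simp: J_def)
  have m[measurable]: "(\<lambda>u. indicator {u. u i = u j} u :: ennreal)
      \<in> borel_measurable (PiM (insert i J) (\<lambda>_. unif01))"
  proof -
    have c: "(\<lambda>u. u k) \<in> borel_measurable (PiM (insert i J) (\<lambda>_. unif01))" if "k \<in> insert i J" for k
      using measurable_component_singleton[OF that, of "\<lambda>_. unif01"] by simp
    have "{u \<in> space (PiM (insert i J) (\<lambda>_. unif01)). u i = u j} \<in> sets (PiM (insert i J) (\<lambda>_. unif01))"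
      using J by (intro borel_measurable_eq c) auto
    then show ?thesis
      by (simp add: borel_measurable_indicator_iff Int_def conj_commute)
  qed
  have "(\<integral>\<^sup>+u. indicator {u. u i = u j} u \<partial>PiM I (\<lambda>_. unif01))
      = (\<integral>\<^sup>+x. \<integral>\<^sup>+v. indicator {u. u i = u j} (x(i := v)) \<partial>unif01 \<partial>PiM J (\<lambda>_. unif01))"
    unfolding J(3) by (rule product_nn_integral_insert[OF J(1,2) m])
  also have "\<dots> = (\<integral>\<^sup>+x. 0 \<partial>PiM J (\<lambda>_. unif01))"
  proof (rule nn_integral_cong)
    fix x :: "'a \<Rightarrow> real"
    have "(\<integral>\<^sup>+v. indicator {u. u i = u j} (x(i := v)) \<partial>unif01) = (\<integral>\<^sup>+v. indicator {x j} v \<partial>unif01)"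
      by (rule nn_integral_cong) (use assms in \<open>auto simp: indicator_def\<close>)
    also have "\<dots> = (\<integral>\<^sup>+v. indicator {0<..<1} v * indicator {x j} v \<partial>lborel)"
      by (subst nn_integral_density) auto
    also have "\<dots> = (\<integral>\<^sup>+v. 0 \<partial>(lborel :: real measure))"
      by (rule nn_integral_cong_AE) (use AE_lborel_singleton[of "x j"] in eventually_elim, simp)
    finally show "(\<integral>\<^sup>+v. indicator {u. u i = u j} (x(i := v)) \<partial>unif01) = 0" by simp
  qed
  finally have "(\<integral>\<^sup>+u. indicator {u. u i = u j} u \<partial>PiM I (\<lambda>_. unif01)) = 0" by simp
  then have "AE u in PiM I (\<lambda>_. unif01). indicator {u. u i = u j} u = (0::ennreal)"
    using m unfolding J(3) by (subst (asm) nn_integral_0_iff_AE) auto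
  then show ?thesis by eventually_elim (auto simp: indicator_def split: if_splits)
qed

subsection \<open>The Hermite-Genocchi formula\<close>

lemma nn_integral_unif01:
  assumes [measurable]: "f \<in> borel_measurable borel" and "0 < s" "s \<le> 1"
  shows "(\<integral>\<^sup>+v. indicator {0<..<s} v * f v \<partial>unif01) = (\<integral>\<^sup>+v. indicator {0<..<s} v * f v \<partial>lborel)"
  by (subst nn_integral_density) (use assms in \<open>auto intro!: nn_integral_cong split: split_indicator\<close>)

text \<open>The indicators cut the sample down to a box while its law stays uniform on the unit
  cube. Thus \<open>s\<close> can vary in an induction over one fixed family of product measures,
  without renormalising.\<close>

definition box_power :: "(nat \<Rightarrow> real) \<Rightarrow> 'i set \<Rightarrow> real \<Rightarrow> nat \<Rightarrow> ('i \<Rightarrow> real) \<Rightarrow> ennreal" where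
  "box_power y I s m u = (\<Prod>i\<in>I. indicator {0<..<s} (u i)) * ennreal (spacing_sum y I u s ^ m)"

lemma borel_measurable_box_power:
  assumes "finite I"
  shows "box_power y I s m \<in> borel_measurable (PiM I (\<lambda>_. unif01))"
proof -
  have c: "(\<lambda>u. u i) \<in> borel_measurable (PiM I (\<lambda>_. unif01))" if "i \<in> I" for i
    using measurable_component_singleton[OF that, of "\<lambda>_. unif01"] by simp
  have [measurable]: "(\<lambda>u. spacing_sum y I u s) \<in> borel_measurable (PiM I (\<lambda>_. unif01))"
    by (rule borel_measurable_spacing_sum[OF assms c])
  have [measurable]: "(\<lambda>u. \<Prod>i\<in>I. indicator {0<..<s} (u i) :: ennreal) \<in> borel_measurable (PiM I (\<lambda>_. unif01))"
    by (intro borel_measurable_prod_ennreal measurable_compose[OF c borel_measurable_indicator]) auto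
  show ?thesis unfolding box_power_def[abs_def] by measurable
qed

text \<open>When \<open>v\<close> is the largest coordinate, the spacing sum is the one for the
  remaining points on (0, v) plus the last term, and the binomial theorem expands its power. Outside
  that region both sides vanish.\<close>

lemma box_power_remove_Max:
  assumes "finite I" "i \<in> I" and y: "\<And>i. 0 \<le> y i"
  shows "indicator {u. \<forall>j\<in>I - {i}. u j < u i} (x(i := v)) * box_power y I s m (x(i := v)) =
    indicator {0<..<s} v * (\<Sum>l\<le>m. ennreal (real (m choose l) * (y (card I)
        * (s - v)) ^ (m - l)) * box_power y (I - {i}) v l x)"
proof (cases "(\<forall>j\<in>I - {i}. x j \<in> {0<..<v}) \<and> v \<in> {0<..<s}")
  case True
  let ?u = "x(i := v)"
  have prod1: "(\<Prod>j\<in>I. indicator {0<..<s} (?u j)) = (1 :: ennreal)"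
  proof (rule prod.neutral, rule ballI)
    fix j assume "j \<in> I"
    then have "?u j \<in> {0<..<s}" using True by (cases "j = i") force+
    then show "indicator {0<..<s} (?u j) = (1 :: ennreal)" by simp
  qed
  have prod2: "(\<Prod>j\<in>I - {i}. indicator {0<..<v} (x j)) = (1 :: ennreal)"
    by (rule prod.neutral) (use True in auto)
  have "spacing_sum y I ?u s = spacing_sum y (I - {i}) ?u (?u i) + y (card I) * (s - ?u i)"
    by (rule spacing_sum_remove_Max) (use True assms in \<open>auto intro: less_imp_le\<close>)
  moreover have "spacing_sum y (I - {i}) ?u v = spacing_sum y (I - {i}) x v"
    by (rule spacing_sum_cong) auto
  ultimately have W: "spacing_sum y I ?u s = spacing_sum y (I - {i}) x v + y (card I) * (s - v)"
    by simp
  have nonneg: "0 \<le> spacing_sum y (I - {i}) x v" "0 \<le> y (card I) * (s - v)"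
    using True assms by (auto intro!: spacing_sum_nonneg intro: less_imp_le)
  have "ennreal (spacing_sum y I ?u s ^ m) =
      (\<Sum>l\<le>m. ennreal (real (m choose l) * spacing_sum y (I - {i}) x v ^ l * (y (card I)
          * (s - v)) ^ (m - l)))"
    unfolding W binomial_ring using nonneg by (subst sum_ennreal) auto
  also have "\<dots> = (\<Sum>l\<le>m. ennreal (real (m choose l) * (y (card I)
      * (s - v)) ^ (m - l)) * box_power y (I - {i}) v l x)"
    unfolding box_power_def prod2 using nonneg
    by (intro sum.cong) (auto simp: ennreal_mult''[symmetric] mult_ac simp del: power_mult_distrib)
  finally have "box_power y I s m ?u = (\<Sum>l\<le>m. ennreal (real (m choose l) * (y (card I)
      * (s - v)) ^ (m - l)) * box_power y (I - {i}) v l x)"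
    unfolding box_power_def[of y I] prod1 by simp
  moreover have "indicator {u. \<forall>j\<in>I - {i}. u j < u i} ?u = (1 :: ennreal)"
    using True by (auto simp: indicator_def)
  ultimately show ?thesis
    using True by simp
next
  case False
  show ?thesis
  proof (cases "v \<in> {0<..<s}")
    case True
    with False obtain j where j: "j \<in> I - {i}" "x j \<notin> {0<..<v}" by auto
    then have "(\<Prod>j\<in>I - {i}. indicator {0<..<v} (x j)) = (0 :: ennreal)"
      using assms(1) j by (intro prod_zero bexI[of _ j]) auto
    then have R: "box_power y (I - {i}) v l x = 0" for l by (simp add: box_power_def)
    show ?thesis
    \<comment> \<open>A coordinate outside (0, v) but below \<open>v\<close> is at most 0, so it
      leaves the box on the left; one that is at least \<open>v\<close> violates the order
      condition.\<close>
    proof (cases "x j < v")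
      case True
      then have "(\<Prod>k\<in>I. indicator {0<..<s} ((x(i := v)) k)) = (0 :: ennreal)"
        using assms(1) j by (intro prod_zero) (auto intro!: bexI[of _ j])
      then show ?thesis by (simp add: box_power_def[of y I] R)
    next
      case False
      then have "indicator {u. \<forall>j\<in>I - {i}. u j < u i} (x(i := v)) = (0::ennreal)"
        using j by (auto simp: indicator_def)
      then show ?thesis by (simp add: R)
    qed
  next
    case False
    then have "(\<Prod>k\<in>I. indicator {0<..<s} ((x(i := v)) k)) = (0 :: ennreal)"
      using assms(1,2) by (intro prod_zero) (auto intro!: bexI[of _ i])
    then show ?thesis using False by (simp add: box_power_def[of y I])
  qed
qed

text \<open>Splitting according to the index and the value \<open>v\<close> of the largest sample point leaves a sample
  from \<open>(0, v)\<close>, so the formula for \<open>card I\<close> points follows by induction for all \<open>s\<close> at once.\<close>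
lemma Hermite_Genocchi_box:
  assumes "finite I" "0 < s" "s \<le> 1" and y: "\<And>i. 0 \<le> y i"
  shows "(\<integral>\<^sup>+u. box_power y I s m u \<partial>PiM I (\<lambda>_. unif01)) =
    ennreal (fact (card I) * fact m / fact (card I + m) * s ^ (card I + m)
        * complete_homogeneous y (Suc (card I)) m)"
  using assms(1-3)
proof (induction "card I" arbitrary: I s m)
  case 0
  then have "I = {}" by simp
  then show ?case
    by (simp add: PiM_empty nn_integral_count_space_finite box_power_def spacing_sum_empty
        complete_homogeneous_1 power_mult_distrib mult.commute)
next
  case (Suc d)
  note I = \<open>finite I\<close> and s = \<open>0 < s\<close> \<open>s \<le> 1\<close> and d = \<open>Suc d = card I\<close>[symmetric]
  interpret unif: prob_space unif01 by (rule prob_space_unif01)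
  interpret product_sigma_finite "\<lambda>_. unif01" by unfold_locales
  let ?P = "PiM I (\<lambda>_. unif01)"
  let ?F = "\<lambda>i u. indicator {u. \<forall>j\<in>I - {i}. u j < u i} u * box_power y I s m u"
  \<comment> \<open>The contribution of one choice of maximal index. It is the same for each index,
    and the \<open>Suc d\<close> choices together turn \<open>fact d\<close> into
    \<open>fact (Suc d)\<close>.\<close>
  define T where "T = fact d * fact m / fact (Suc d + m) * s ^ (Suc d + m)
      * complete_homogeneous y (Suc (Suc d)) m"
  have "I \<noteq> {}" using d by auto
  have [measurable]: "box_power y I s m \<in> borel_measurable ?P"
    by (rule borel_measurable_box_power[OF I])
  have comp[measurable]: "(\<lambda>u. u i) \<in> borel_measurable ?P" if "i \<in> I" for i
    using measurable_component_singleton[OF that, of "\<lambda>_. unif01"] by simp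
  have meas: "?F i \<in> borel_measurable ?P" if "i \<in> I" for i
  proof -
    have [measurable]: "i \<in> I" by fact
    have "(\<lambda>u. (\<Prod>j\<in>I - {i}. if u j < u i then 1 else 0) * box_power y I s m u) \<in> borel_measurable ?P"
      using that by (intro borel_measurable_times_ennreal borel_measurable_prod_ennreal) (auto, measurable)
    also have "(\<lambda>u. (\<Prod>j\<in>I - {i}. if u j < u i then 1 else 0) * box_power y I s m u) = ?F i"
      using I by (intro ext arg_cong2[where f = "(*)"] refl)
        (auto simp: indicator_def intro!: prod.neutral)
    finally show ?thesis .
  qed
  have part: "(\<integral>\<^sup>+u. ?F i u \<partial>?P) = ennreal T" if "i \<in> I" for i
  proof -
    have J: "finite (I - {i})" "i \<notin> I - {i}" "insert i (I - {i}) = I" "card (I - {i}) = d"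
      using I that d by auto
    \<comment> \<open>Everything in the \<open>l\<close>-th binomial term that does not depend on
      \<open>v\<close>, once the induction hypothesis has been applied on (0, v).\<close>
    define c where "c l = real (m choose l) * y (Suc d) ^ (m - l)
        * (fact d * fact l / fact (d + l) * complete_homogeneous y (Suc d) l)" for l
    have c: "0 \<le> c l" for l
      using y unfolding c_def by (intro mult_nonneg_nonneg complete_homogeneous_nonneg divide_nonneg_nonneg) auto
    \<comment> \<open>The maximum \<open>v\<close> is integrated last, so that the inner integral is
      the formula for \<open>d\<close> points with right end \<open>v\<close>.\<close>
    have "(\<integral>\<^sup>+u. ?F i u \<partial>?P) = (\<integral>\<^sup>+v. \<integral>\<^sup>+x. ?F i (x(i := v)) \<partial>PiM (I - {i}) (\<lambda>_. unif01) \<partial>unif01)"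
      using product_nn_integral_insert_rev[OF J(1,2), of "?F i"] meas[OF that] unfolding J(3) by simp
    also have "\<dots> = (\<integral>\<^sup>+v. indicator {0<..<s} v * (\<Sum>l\<le>m. ennreal (c l) * ennreal (v ^ (d + l)
        * (s - v) ^ (m - l))) \<partial>unif01)"
    proof (rule nn_integral_cong)
      fix v :: real
      let ?a = "\<lambda>l. real (m choose l) * (y (Suc d) * (s - v)) ^ (m - l)"
      note [measurable] = borel_measurable_box_power[OF J(1)]
      have "(\<integral>\<^sup>+x. ?F i (x(i := v)) \<partial>PiM (I - {i}) (\<lambda>_. unif01)) =
          (\<integral>\<^sup>+x. indicator {0<..<s} v * (\<Sum>l\<le>m. ennreal (?a l) * box_power y (I - {i}) v l x)
              \<partial>PiM (I - {i}) (\<lambda>_. unif01))"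
        unfolding box_power_remove_Max[OF I that y] d ..
      also have "\<dots> = indicator {0<..<s} v * (\<Sum>l\<le>m. ennreal (?a l)
          * (\<integral>\<^sup>+x. box_power y (I - {i}) v l x \<partial>PiM (I - {i}) (\<lambda>_. unif01)))"
        by (simp add: nn_integral_cmult nn_integral_sum)
      also have "\<dots> = indicator {0<..<s} v * (\<Sum>l\<le>m. ennreal (c l) * ennreal (v ^ (d + l)
          * (s - v) ^ (m - l)))"
      proof (cases "v \<in> {0<..<s}")
        case True
        then have "(\<integral>\<^sup>+x. box_power y (I - {i}) v l x \<partial>PiM (I - {i}) (\<lambda>_. unif01)) =
          ennreal (fact d * fact l / fact (d + l) * v ^ (d + l)
              * complete_homogeneous y (Suc d) l)" for l
          using Suc.hyps(1)[of "I - {i}" v l] J s by simp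
        moreover have "ennreal (?a l) * ennreal (fact d * fact l / fact (d + l) * v ^ (d + l)
            * complete_homogeneous y (Suc d) l)
            = ennreal (c l) * ennreal (v ^ (d + l) * (s - v) ^ (m - l))" for l
        proof -
          have "0 \<le> ?a l" using True y by (intro mult_nonneg_nonneg zero_le_power) auto
          then show ?thesis
            by (simp only: ennreal_mult'[symmetric] c) (simp add: c_def power_mult_distrib mult_ac)
        qed
        ultimately show ?thesis by simp
      qed simp
      finally show "(\<integral>\<^sup>+x. ?F i (x(i := v)) \<partial>PiM (I - {i}) (\<lambda>_. unif01)) =
        indicator {0<..<s} v * (\<Sum>l\<le>m. ennreal (c l) * ennreal (v ^ (d + l) * (s - v) ^ (m - l)))" .
    qed
    also have "\<dots> = (\<integral>\<^sup>+v. indicator {0<..<s} v * (\<Sum>l\<le>m. ennreal (c l) * ennreal (v ^ (d + l)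
        * (s - v) ^ (m - l))) \<partial>lborel)"
      by (rule nn_integral_unif01[OF _ s]) measurable
    also have "\<dots> = (\<integral>\<^sup>+v. (\<Sum>l\<le>m. ennreal (c l) * (indicator {0<..<s} v * ennreal (v ^ (d + l)
        * (s - v) ^ (m - l)))) \<partial>lborel)"
      by (simp add: sum_distrib_left mult_ac)
    also have "\<dots> = (\<Sum>l\<le>m. ennreal (c l) * ennreal (fact (d + l) * fact (m - l) / fact (d + l
        + (m - l) + 1) * s ^ (d + l + (m - l) + 1)))"
      by (simp add: nn_integral_sum nn_integral_cmult nn_integral_Beta_nat[OF s(1)] del: fact_Suc)
    also have "\<dots> = (\<Sum>l\<le>m. ennreal (fact d * fact m / fact (Suc d + m) * s ^ (Suc d + m) *
                        (complete_homogeneous y (Suc d) l * y (Suc d) ^ (m - l))))"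
    \<comment> \<open>The Beta integral cancels \<open>fact (d + l)\<close> from the induction
      hypothesis, and the binomial coefficient cancels \<open>fact l\<close> and
      \<open>fact (m - l)\<close>. What still depends on \<open>l\<close> is the summand of
      \<open>complete_homogeneous_Suc\<close>.\<close>
    proof (rule sum.cong[OF refl])
      fix l assume "l \<in> {..m}"
      then have l: "l \<le> m" by simp
      then have "d + l + (m - l) + 1 = Suc d + m" by simp
      moreover have "real (m choose l) = fact m / (fact l * fact (m - l))"
        using l by (rule binomial_fact)
      ultimately have "c l * (fact (d + l) * fact (m - l) / fact (d + l + (m - l) + 1) * s ^ (d
          + l + (m - l) + 1))
          = fact d * fact m / fact (Suc d + m) * s ^ (Suc d + m)
              * (complete_homogeneous y (Suc d) l * y (Suc d) ^ (m - l))"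
        by (simp add: c_def del: fact_Suc)
      then show "ennreal (c l) * ennreal (fact (d + l) * fact (m - l) / fact (d + l + (m - l) + 1)
          * s ^ (d + l + (m - l) + 1))
          = ennreal (fact d * fact m / fact (Suc d + m) * s ^ (Suc d + m)
              * (complete_homogeneous y (Suc d) l * y (Suc d) ^ (m - l)))"
        using c[of l] by (simp only: ennreal_mult'[symmetric])
    qed
    also have "\<dots> = ennreal T"
    proof (subst sum_ennreal)
      show "0 \<le> fact d * fact m / fact (Suc d + m) * s ^ (Suc d + m)
          * (complete_homogeneous y (Suc d) l * y (Suc d) ^ (m - l))" for l
        using y s by (intro mult_nonneg_nonneg complete_homogeneous_nonneg divide_nonneg_nonneg) auto
    qed (simp only: T_def complete_homogeneous_Suc[of y "Suc d"] sum_distrib_left)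
    finally show ?thesis .
  qed
  have "AE u in ?P. \<forall>i\<in>I. \<forall>j\<in>I - {i}. u i \<noteq> u j"
    by (intro AE_finite_allI finite_Diff I AE_PiM_unif01_distinct) auto
  \<comment> \<open>Without ties exactly one index is strictly maximal, so exactly one of the
    ordering indicators is 1.\<close>
  then have "AE u in ?P. box_power y I s m u = (\<Sum>i\<in>I. ?F i u)"
  proof eventually_elim
    case (elim u)
    obtain i where i: "i \<in> I" "\<forall>j\<in>I. u j \<le> u i"
      using ex_Max_image[OF I \<open>I \<noteq> {}\<close>] by blast
    have "?F j u = 0" if "j \<in> I - {i}" for j
      using that i by (auto simp: indicator_def not_less intro!: bexI[of _ i])
    then have "(\<Sum>j\<in>I - {i}. ?F j u) = 0"
      by (rule sum.neutral[OF ballI])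
    then have "(\<Sum>j\<in>I. ?F j u) = ?F i u"
      by (subst sum.remove[OF I i(1)]) (simp only: add_0_right)
    also have "\<dots> = box_power y I s m u"
      using i elim by (auto simp: indicator_def less_le)
    finally show ?case by simp
  qed
  then have "(\<integral>\<^sup>+u. box_power y I s m u \<partial>?P) = (\<integral>\<^sup>+u. (\<Sum>i\<in>I. ?F i u) \<partial>?P)"
    by (rule nn_integral_cong_AE)
  also have "\<dots> = (\<Sum>i\<in>I. ennreal T)"
    by (subst nn_integral_sum) (use meas part in auto)
  also have "\<dots> = ennreal (real (Suc d) * T)"
    by (simp add: d ennreal_mult' ennreal_of_nat_eq_real_of_nat)
  also have "real (Suc d) * T = fact (card I) * fact m / fact (card I + m) * s ^ (card I + m)
      * complete_homogeneous y (Suc (card I)) m"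
    unfolding d T_def fact_Suc[of d] by (simp add: mult_ac del: of_nat_Suc)
  finally show ?case .
qed

subsection \<open>Random weights\<close>

text \<open>The set \<open>{1..<n}\<close> has \<open>n - 1\<close> elements, so index
  \<open>n\<close> is past the sample and gives the end point 1, as the convention requires.\<close>

lemma order_stat_on_eq_order_statistic:
  assumes "1 \<le> n" "j \<le> n"
  shows "order_stat_on {1..<n} u 1 j = order_statistic n u j"
proof -
  have "sort (map u [1..<n]) = sorted_list_of_multiset (image_mset u (mset_set {1..<n}))"
    by (metis mset_map mset_upt sorted_list_of_multiset_mset)
  then show ?thesis
    using assms by (auto simp: order_stat_on_def order_statistic_def)
qed

text \<open>Sends the number of a spacing, counted from 0, to the number of the random weight
  containing it, counted from 1. Monotonicity of \<open>N\<close> makes the least candidate the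
  right one.\<close>

definition block :: "(nat \<Rightarrow> nat) \<Rightarrow> nat \<Rightarrow> nat" where
  "block N i = (LEAST j. i < N j)"

lemma block_eq:
  assumes N: "strict_mono_on {0..k} N" and "j \<in> {1..k}" "N (j - 1) \<le> i" "i < N j"
  shows "block N i = j"
  unfolding block_def
proof (rule Least_equality)
  fix l assume l: "i < N l"
  show "j \<le> l"
  proof (rule ccontr)
    assume "\<not> j \<le> l"
    then have "l \<le> j - 1" "j - 1 \<le> k" using assms(2) by auto
    then have "N l \<le> N (j - 1)"
      using strict_mono_onD[OF N, of l "j - 1"] by (cases "l = j - 1") auto
    then show False using l assms(3) by simp
  qed
qed fact

lemma block_mem:
  assumes N: "strict_mono_on {0..k} N" and "N 0 = 0" "i < N k"
  shows "block N i \<in> {1..k}"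
proof -
  have "i < N (block N i)" unfolding block_def by (rule LeastI[of _ k]) fact
  then have "block N i \<noteq> 0" using assms(2) by (metis not_less0)
  moreover have "block N i \<le> k" unfolding block_def by (rule Least_le) fact
  ultimately show ?thesis by simp
qed

context
  fixes k :: nat and N :: "nat \<Rightarrow> nat"
  assumes N: "strict_mono_on {0..k} N" and N0: "N 0 = 0"
begin

text \<open>On each block the coefficient is constant and the increments of \<open>h\<close>
  telescope. The bound \<open>K\<close> is free for induction on the number of blocks.\<close>

lemma sum_block:
  fixes h :: "nat \<Rightarrow> real"
  assumes "K \<le> k"
  shows "(\<Sum>i<N K. x (block N i) * (h (Suc i) - h i)) = (\<Sum>j=1..K. x j * (h (N j) - h (N (j - 1))))"
  using assms
proof (induction K)
  case 0
  show ?case by (simp add: N0)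
next
  case (Suc K)
  have le: "N K \<le> N (Suc K)" using strict_mono_onD[OF N, of K "Suc K"] Suc.prems by simp
  have "(\<Sum>i<N (Suc K). x (block N i) * (h (Suc i) - h i)) =
      (\<Sum>i<N K. x (block N i) * (h (Suc i) - h i)) + (\<Sum>i=N K..<N (Suc K). x (block N i)
          * (h (Suc i) - h i))"
    using le by (simp add: lessThan_atLeast0 sum.atLeastLessThan_concat)
  also have "(\<Sum>i=N K..<N (Suc K). x (block N i) * (h (Suc i) - h i))
      = (\<Sum>i=N K..<N (Suc K). x (Suc K) * (h (Suc i) - h i))"
    by (intro sum.cong refl) (use block_eq[OF N, of "Suc K"] Suc.prems in auto)
  also have "\<dots> = x (Suc K) * (h (N (Suc K)) - h (N K))"
    unfolding sum_distrib_left[symmetric] sum_Suc_diff'[OF le] ..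
  finally show ?case using Suc by simp
qed

lemma prod_block:
  fixes g :: "nat \<Rightarrow> 'b :: comm_monoid_mult"
  assumes "K \<le> k"
  shows "(\<Prod>i<N K. g (block N i)) = (\<Prod>j=1..K. g j ^ (N j - N (j - 1)))"
  using assms
proof (induction K)
  case 0
  show ?case by (simp add: N0)
next
  case (Suc K)
  have le: "N K \<le> N (Suc K)" using strict_mono_onD[OF N, of K "Suc K"] Suc.prems by simp
  have "(\<Prod>i<N (Suc K). g (block N i)) = (\<Prod>i<N K. g (block N i)) * (\<Prod>i=N K..<N (Suc K). g (block N i))"
    using le by (simp add: lessThan_atLeast0 prod.atLeastLessThan_concat)
  also have "(\<Prod>i=N K..<N (Suc K). g (block N i)) = (\<Prod>i=N K..<N (Suc K). g (Suc K))"
    by (intro prod.cong refl) (use block_eq[OF N, of "Suc K"] Suc.prems in auto)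
  finally show ?case using Suc by simp
qed

text \<open>The weights are cut off to 0 from \<open>n\<close> on because \<open>block N i\<close>
  is not controlled there, while the Hermite-Genocchi results ask for nonnegative weights at every
  index.\<close>

lemma sum_random_weight:
  assumes n: "N k = n" "1 \<le> n"
  shows "(\<Sum>j=1..k. random_weight n N u j * x j)
      = spacing_sum (\<lambda>i. if i < n then x (block N i) else 0) {1..<n} u 1"
proof -
  have le: "N j \<le> n" if "j \<le> k" for j
    using strict_mono_onD[OF N, of j k] that n by (cases "j = k") auto
  have "spacing_sum (\<lambda>i. if i < n then x (block N i) else 0) {1..<n} u 1 =
     (\<Sum>i<N k. x (block N i) * (order_statistic n u (Suc i) - order_statistic n u i))"
    unfolding spacing_sum_def using n
    by (intro sum.cong) (auto simp: order_stat_on_eq_order_statistic[OF n(2), unfolded One_nat_def])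
  also have "\<dots> = (\<Sum>j=1..k. x j * (order_statistic n u (N j) - order_statistic n u (N (j - 1))))"
    by (rule sum_block) simp
  finally show ?thesis by (simp add: random_weight_def mult.commute)
qed

lemma sum_random_weight_1:
  assumes "N k = n" "1 \<le> n"
  shows "(\<Sum>j=1..k. random_weight n N u j) = 1"
proof -
  have "(\<Sum>j=1..k. random_weight n N u j) = (\<Sum>i<N k. 1
      * (order_statistic n u (Suc i) - order_statistic n u i))"
    using sum_block[of k "\<lambda>_. 1" "order_statistic n u"] by (simp add: random_weight_def)
  also have "\<dots> = order_statistic n u n - order_statistic n u 0"
    using sum_lessThan_telescope[of "order_statistic n u" n] assms by simp
  finally show ?thesis using assms by (simp add: order_statistic_def)
qed

lemma complete_homogeneous_block:
  assumes "N k = n"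
  shows "complete_homogeneous (\<lambda>i. if i < n then x (block N i) else 0) n m =
    fps_nth (\<Prod>j=1..k. Abs_fps (\<lambda>l. x j ^ l) ^ (N j - N (j - 1))) m"
proof -
  have "(\<Prod>i<n. Abs_fps (\<lambda>l. (if i < n then x (block N i) else 0) ^ l))
      = (\<Prod>i<N k. Abs_fps (\<lambda>l. x (block N i) ^ l))"
    using assms by (intro prod.cong) auto
  then show ?thesis
    unfolding complete_homogeneous_def
    using prod_block[of k "\<lambda>j. Abs_fps (\<lambda>l. x j ^ l)"] by simp
qed

end

text \<open>The negative binomial series: one more geometric factor sums the coefficients along a
  diagonal of Pascal's triangle, the hockey-stick identity.\<close>

lemma fps_nth_geometric_power:
  fixes x :: real
  shows "fps_nth (Abs_fps (\<lambda>l. x ^ l) ^ Suc r) i = real ((r + i) choose i) * x ^ i"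
proof (induction r arbitrary: i)
  case 0
  show ?case by simp
next
  case (Suc r)
  have "fps_nth (Abs_fps (\<lambda>l. x ^ l) ^ Suc (Suc r)) i
      = (\<Sum>l\<le>i. fps_nth (Abs_fps (\<lambda>l. x ^ l) ^ Suc r) l * x ^ (i - l))"
    by (subst power_Suc2) (simp add: fps_mult_nth atLeast0AtMost del: power_Suc)
  also have "\<dots> = (\<Sum>l\<le>i. real ((r + l) choose l) * x ^ i)"
    unfolding Suc.IH by (intro sum.cong) (simp_all add: mult.assoc power_add[symmetric])
  also have "\<dots> = real (\<Sum>l\<le>i. (r + l) choose l) * x ^ i"
    by (simp add: sum_distrib_right)
  also have "\<dots> = real ((Suc r + i) choose i) * x ^ i"
    unfolding sum_choose_lower by simp
  finally show ?case .
qed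

text \<open>A multiset \<open>Z\<close> of size \<open>m\<close> records the degree
  \<open>count Z j\<close> taken from factor \<open>j\<close>. The degrees add up to
  \<open>m\<close>, so the powers of 4 combine, and the rest is the \<open>m\<close>-th coefficient
  of a product of Catalan powers, whose exponents add.\<close>

lemma sum_multisets_ballot:
  assumes "finite J" "\<And>j. j \<in> J \<Longrightarrow> 0 < r j"
  shows "(\<Sum>Z\<in>multisets_of_size J m. \<Prod>j\<in>J. real ((r j - 1 + count Z j) choose count Z j)
      * sym_beta_moment (r j) (count Z j))
     = ballot (2 * (\<Sum>j\<in>J. r j)) m / 4 ^ m"
proof -
  have "(\<Prod>j\<in>J. real ((r j - 1 + count Z j) choose count Z j) * sym_beta_moment (r j) (count Z j))
      = (\<Prod>j\<in>J. fps_nth (ballot_fps (2 * r j)) (count Z j)) / 4 ^ m" if "Z \<in> multisets_of_size J m" for Z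
  proof -
    have Z: "set_mset Z \<subseteq> J" "size Z = m" using that by (auto simp: multisets_of_size_def)
    then have "m = (\<Sum>j\<in>J. count Z j)"
      using assms(1) by (auto simp: size_multiset_overloaded_eq not_in_iff intro!: sum.mono_neutral_left)
    then have "(4 :: real) ^ m = (\<Prod>j\<in>J. 4 ^ count Z j)"
      by (simp add: power_sum)
    show ?thesis
      unfolding \<open>4 ^ m = _\<close> prod_dividef[symmetric]
      by (intro prod.cong) (simp_all add: choose_times_moment[OF assms(2)] ballot_fps_def
          del: One_nat_def)
  qed
  then have "(\<Sum>Z\<in>multisets_of_size J m. \<Prod>j\<in>J. real ((r j - 1 + count Z j) choose count Z j)
      * sym_beta_moment (r j) (count Z j))
      = (\<Sum>Z\<in>multisets_of_size J m. \<Prod>j\<in>J. fps_nth (ballot_fps (2 * r j)) (count Z j)) / 4 ^ m"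
    by (simp add: sum_divide_distrib)
  also have "\<dots> = fps_nth (ballot_fps (\<Sum>j\<in>J. 2 * r j)) m / 4 ^ m"
    by (simp add: ballot_fps_sum fps_prod_nth'[OF assms(1)])
  finally show ?thesis
    by (simp add: ballot_fps_def sum_distrib_left)
qed

text \<open>Independence makes the joint law a product, so Tonelli's theorem integrates over
  \<open>X\<close> with \<open>Y\<close> frozen. This stands in for conditioning on the value of
  \<open>Y\<close>.\<close>

lemma (in prob_space) nn_integral_indep_var:
  assumes indep: "indep_var S X T Y" and [measurable]: "g \<in> borel_measurable (S \<Otimes>\<^sub>M T)"
  shows "(\<integral>\<^sup>+\<omega>. g (X \<omega>, Y \<omega>) \<partial>M) = (\<integral>\<^sup>+\<omega>. \<integral>\<^sup>+\<omega>'. g (X \<omega>', Y \<omega>) \<partial>M \<partial>M)"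
proof -
  have [measurable]: "X \<in> measurable M S" "Y \<in> measurable M T"
    using indep by (simp_all add: indep_var_distribution_eq)
  interpret X: prob_space "distr M S X" by (rule prob_space_distr) measurable
  interpret Y: prob_space "distr M T Y" by (rule prob_space_distr) measurable
  interpret pair_sigma_finite "distr M S X" "distr M T Y" ..
  have "(\<integral>\<^sup>+\<omega>. g (X \<omega>, Y \<omega>) \<partial>M) = (\<integral>\<^sup>+z. g z \<partial>distr M (S \<Otimes>\<^sub>M T) (\<lambda>\<omega>. (X \<omega>, Y \<omega>)))"
    by (simp add: nn_integral_distr)
  also have "\<dots> = (\<integral>\<^sup>+z. g z \<partial>(distr M S X \<Otimes>\<^sub>M distr M T Y))"
    using indep by (simp add: indep_var_distribution_eq)
  also have "\<dots> = (\<integral>\<^sup>+y. \<integral>\<^sup>+x. g (x, y) \<partial>distr M S X \<partial>distr M T Y)"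
    by (rule nn_integral_snd[symmetric]) simp
  also have "\<dots> = (\<integral>\<^sup>+\<omega>. \<integral>\<^sup>+x. g (x, Y \<omega>) \<partial>distr M S X \<partial>M)"
    by (rule nn_integral_distr) measurable
  also have "\<dots> = (\<integral>\<^sup>+\<omega>. \<integral>\<^sup>+\<omega>'. g (X \<omega>', Y \<omega>) \<partial>M \<partial>M)"
  proof (rule nn_integral_cong)
    fix \<omega> assume "\<omega> \<in> space M"
    then have [measurable]: "Y \<omega> \<in> space T" using measurable_space[of Y M T] by simp
    show "(\<integral>\<^sup>+x. g (x, Y \<omega>) \<partial>distr M S X) = (\<integral>\<^sup>+\<omega>'. g (X \<omega>', Y \<omega>) \<partial>M)"
      by (rule nn_integral_distr) measurable
  qed
  finally show ?thesis .
qed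

section \<open>Moments of the average for fixed values\<close>

lemma AE_unif01_range:
  assumes "finite I" "\<And>i. i \<in> I \<Longrightarrow> U i \<in> borel_measurable M" "\<And>i. i \<in> I \<Longrightarrow> distr M borel (U i) = unif01"
  shows "AE \<omega> in M. \<forall>i\<in>I. U i \<omega> \<in> {0<..<1}"
proof (rule AE_finite_allI[OF assms(1)])
  fix i assume i: "i \<in> I"
  have "AE x in unif01. x \<in> {0<..<1}"
    by (subst AE_density) (auto simp: indicator_def)
  then show "AE \<omega> in M. U i \<omega> \<in> {0<..<1}"
    unfolding assms(3)[OF i, symmetric] by (subst (asm) AE_distr_iff) (use assms(2)[OF i] in auto)
qed

text \<open>Independence identifies the law of the sample with the product measure, and almost
  surely the sample lies in the unit box, where the indicators at \<open>s = 1\<close> equal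
  1.\<close>

lemma (in prob_space) nn_integral_spacing_sum_power:
  assumes I: "finite I" "I \<noteq> {}" and indep: "indep_vars (\<lambda>_. borel) U I"
    and U: "\<And>i. i \<in> I \<Longrightarrow> distr M borel (U i) = unif01"
    and y: "\<And>i. 0 \<le> y i"
  shows "(\<integral>\<^sup>+\<omega>. ennreal (spacing_sum y I (\<lambda>i. U i \<omega>) 1 ^ m) \<partial>M) =
    ennreal (fact (card I) * fact m / fact (card I + m) * complete_homogeneous y (Suc (card I)) m)"
proof -
  have [measurable]: "U i \<in> borel_measurable M" if "i \<in> I" for i
    using indep that by (auto simp: indep_vars_def)
  have "sets (PiM I (\<lambda>_. unif01)) = sets (PiM I (\<lambda>_. borel))" by (intro sets_PiM_cong) auto
  then have box: "box_power y I 1 m \<in> borel_measurable (PiM I (\<lambda>_. borel))"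
    using borel_measurable_box_power[OF I(1)] measurable_cong_sets by blast
  have "AE \<omega> in M. \<forall>i\<in>I. U i \<omega> \<in> {0<..<1}"
    using I(1) U by (intro AE_unif01_range) auto
  then have "AE \<omega> in M. ennreal (spacing_sum y I (\<lambda>i. U i \<omega>) 1 ^ m) = box_power y I 1 m (\<lambda>i\<in>I. U i \<omega>)"
  proof eventually_elim
    case (elim \<omega>)
    then have "(\<Prod>i\<in>I. indicator {0<..<1} ((\<lambda>i\<in>I. U i \<omega>) i)) = (1 :: ennreal)"
      by (intro prod.neutral) auto
    moreover have "spacing_sum y I (\<lambda>i\<in>I. U i \<omega>) 1 = spacing_sum y I (\<lambda>i. U i \<omega>) 1"
      by (rule spacing_sum_cong) simp
    ultimately show ?case unfolding box_power_def by simp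
  qed
  then have "(\<integral>\<^sup>+\<omega>. ennreal (spacing_sum y I (\<lambda>i. U i \<omega>) 1 ^ m) \<partial>M)
     = (\<integral>\<^sup>+\<omega>. box_power y I 1 m (\<lambda>i\<in>I. U i \<omega>) \<partial>M)"
    by (rule nn_integral_cong_AE)
  also have "\<dots> = (\<integral>\<^sup>+u. box_power y I 1 m u \<partial>distr M (PiM I (\<lambda>_. borel)) (\<lambda>\<omega>. \<lambda>i\<in>I. U i \<omega>))"
    by (rule nn_integral_distr[symmetric]) (use box in measurable)
  also have "distr M (PiM I (\<lambda>_. borel)) (\<lambda>\<omega>. \<lambda>i\<in>I. U i \<omega>) = PiM I (\<lambda>i. distr M borel (U i))"
    using indep_vars_iff_distr_eq_PiM'[OF I(2), of U "\<lambda>_. borel"] indep by simp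
  also have "\<dots> = PiM I (\<lambda>_. unif01)"
    by (intro PiM_cong refl U)
  also have "(\<integral>\<^sup>+u. box_power y I 1 m u \<partial>PiM I (\<lambda>_. unif01)) =
    ennreal (fact (card I) * fact m / fact (card I + m) * complete_homogeneous y (Suc (card I)) m)"
    using Hermite_Genocchi_box[OF I(1), of 1 y m] y by simp
  finally show ?thesis .
qed

subsection \<open>Averages of beta variables\<close>

lemma (in prob_space) rescaled_beta_distributed:
  assumes D: "distributed M lborel X (\<lambda>x. ennreal (beta_density a b (real r + 1/2) (real r
      + 1/2) x))" and "a < b"
  shows "AE \<omega> in M. (X \<omega> - a) / (b - a) \<in> {0<..<1}"
    and "(\<integral>\<^sup>+\<omega>. ennreal (((X \<omega> - a) / (b - a)) ^ m) \<partial>M) = ennreal (sym_beta_moment r m)"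
proof -
  let ?p = "real r + 1/2"
  have p: "0 < ?p" by simp
  have [measurable]: "X \<in> borel_measurable M" using distributed_measurable[OF D] by simp
  have "AE x in lborel. 0 < ennreal (beta_density a b ?p ?p x) \<longrightarrow> x \<in> {a<..<b}"
    by (auto simp: beta_density_def)
  then have "AE \<omega> in M. X \<omega> \<in> {a<..<b}"
    by (subst distributed_AE2[OF D]) auto
  then show "AE \<omega> in M. (X \<omega> - a) / (b - a) \<in> {0<..<1}"
    by eventually_elim (use \<open>a < b\<close> in \<open>auto simp: divide_simps\<close>)
  have "(\<integral>\<^sup>+\<omega>. ennreal (((X \<omega> - a) / (b - a)) ^ m) \<partial>M) =
      (\<integral>\<^sup>+x. ennreal (beta_density a b ?p ?p x) * ennreal (((x - a) / (b - a)) ^ m) \<partial>lborel)"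
    by (rule distributed_nn_integral[OF D, symmetric]) measurable
  also have "\<dots> = ennreal (b - a) * (\<integral>\<^sup>+x. ennreal (beta_density a b ?p ?p (a + (b - a) * x))
      * ennreal (((a + (b - a) * x - a) / (b - a)) ^ m) \<partial>lborel)"
    using \<open>a < b\<close> by (subst nn_integral_real_affine[where c = "b - a" and t = a]) auto
  also have "\<dots> = (\<integral>\<^sup>+x. ennreal (b - a) * (ennreal (beta_density a b ?p ?p (a + (b - a) * x))
      * ennreal (((a + (b - a) * x - a) / (b - a)) ^ m)) \<partial>lborel)"
    by (rule nn_integral_cmult[symmetric]) measurable
  also have "\<dots> = (\<integral>\<^sup>+x. ennreal (beta_density 0 1 ?p ?p x) * ennreal (x ^ m) \<partial>lborel)"
  proof (rule nn_integral_cong)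
    fix x :: real
    have "ennreal (b - a) * ennreal (beta_density 0 1 ?p ?p x / (b - a))
        = ennreal (beta_density 0 1 ?p ?p x)"
      using \<open>a < b\<close> by (subst ennreal_mult'[symmetric]) auto
    then show "ennreal (b - a) * (ennreal (beta_density a b ?p ?p (a + (b - a) * x))
        * ennreal (((a + (b - a) * x - a) / (b - a)) ^ m))
        = ennreal (beta_density 0 1 ?p ?p x) * ennreal (x ^ m)"
      using \<open>a < b\<close> by (simp add: beta_density_affine mult.assoc[symmetric])
  qed
  also have "\<dots> = ennreal (sym_beta_moment r m)"
    using nn_integral_beta_density_power[OF p p, of m] by (simp add: sym_beta_moment_def)
  finally show "(\<integral>\<^sup>+\<omega>. ennreal (((X \<omega> - a) / (b - a)) ^ m) \<partial>M) = ennreal (sym_beta_moment r m)" .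
qed

lemma sym_beta_moment_nonneg: "0 \<le> sym_beta_moment r m"
  unfolding sym_beta_moment_def Beta_def
  by (intro divide_nonneg_nonneg mult_nonneg_nonneg less_imp_le[OF Gamma_real_pos]) auto

text \<open>Expanding the coefficient over multisets exposes products of powers of the separate
  \<open>Y j\<close>; their expectations factor by independence, so each series is averaged on its
  own.\<close>

lemma (in prob_space) nn_integral_prod_geometric_power:
  assumes J: "finite J" and r: "\<And>j. j \<in> J \<Longrightarrow> 0 < r j"
    and indep: "indep_vars (\<lambda>_. borel) Y J"
    and pos: "\<And>j. j \<in> J \<Longrightarrow> AE \<omega> in M. 0 \<le> (Y j \<omega> :: real)"
    and mom: "\<And>j m. j \<in> J \<Longrightarrow> (\<integral>\<^sup>+\<omega>. ennreal (Y j \<omega> ^ m) \<partial>M) = ennreal (sym_beta_moment (r j) m)"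
  shows "(\<integral>\<^sup>+\<omega>. ennreal (fps_nth (\<Prod>j\<in>J. Abs_fps (\<lambda>l. Y j \<omega> ^ l) ^ r j) m) \<partial>M) =
    ennreal (ballot (2 * (\<Sum>j\<in>J. r j)) m / 4 ^ m)"
proof -
  have [measurable]: "Y j \<in> borel_measurable M" if "j \<in> J" for j
    using indep that by (auto simp: indep_vars_def)
  let ?C = "\<lambda>j l. real ((r j - 1 + l) choose l)"
  let ?Z = "multisets_of_size J m"
  have "AE \<omega> in M. \<forall>j\<in>J. 0 \<le> Y j \<omega>"
    using J pos by (intro AE_finite_allI) auto
  then have "AE \<omega> in M. ennreal (fps_nth (\<Prod>j\<in>J. Abs_fps (\<lambda>l. Y j \<omega> ^ l) ^ r j) m) =
      (\<Sum>Z\<in>?Z. \<Prod>j\<in>J. ennreal (?C j (count Z j) * Y j \<omega> ^ count Z j))"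
  proof eventually_elim
    case (elim \<omega>)
    have "fps_nth (Abs_fps (\<lambda>l. Y j \<omega> ^ l) ^ r j) i = ?C j i * Y j \<omega> ^ i" if "j \<in> J" for i j
      using fps_nth_geometric_power[of "Y j \<omega>" "r j - 1" i] r[OF that] by simp
    then have "fps_nth (\<Prod>j\<in>J. Abs_fps (\<lambda>l. Y j \<omega> ^ l) ^ r j) m =
        (\<Sum>Z\<in>?Z. \<Prod>j\<in>J. ?C j (count Z j) * Y j \<omega> ^ count Z j)"
      by (simp add: fps_prod_nth'[OF J])
    then show ?case
      using elim by (subst prod_ennreal) (auto simp: sum_ennreal prod_nonneg)
  qed
  then have "(\<integral>\<^sup>+\<omega>. ennreal (fps_nth (\<Prod>j\<in>J. Abs_fps (\<lambda>l. Y j \<omega> ^ l) ^ r j) m) \<partial>M) =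
      (\<integral>\<^sup>+\<omega>. (\<Sum>Z\<in>?Z. \<Prod>j\<in>J. ennreal (?C j (count Z j) * Y j \<omega> ^ count Z j)) \<partial>M)"
    by (rule nn_integral_cong_AE)
  also have "\<dots> = (\<Sum>Z\<in>?Z. \<integral>\<^sup>+\<omega>. (\<Prod>j\<in>J. ennreal (?C j (count Z j) * Y j \<omega> ^ count Z j)) \<partial>M)"
    by (rule nn_integral_sum) measurable
  also have "\<dots> = (\<Sum>Z\<in>?Z. \<Prod>j\<in>J. ennreal (?C j (count Z j) * sym_beta_moment (r j) (count Z j)))"
  proof (rule sum.cong[OF refl])
    fix Z
    have "indep_vars (\<lambda>_. borel) (\<lambda>j \<omega>. ennreal (?C j (count Z j) * Y j \<omega> ^ count Z j)) J"
      by (rule indep_vars_compose2[OF indep]) measurable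
    then have "(\<integral>\<^sup>+\<omega>. (\<Prod>j\<in>J. ennreal (?C j (count Z j) * Y j \<omega> ^ count Z j)) \<partial>M) =
        (\<Prod>j\<in>J. \<integral>\<^sup>+\<omega>. ennreal (?C j (count Z j) * Y j \<omega> ^ count Z j) \<partial>M)"
      by (intro indep_vars_nn_integral J) auto
    also have "\<dots> = (\<Prod>j\<in>J. ennreal (?C j (count Z j) * sym_beta_moment (r j) (count Z j)))"
    proof (rule prod.cong[OF refl])
      fix j assume j: "j \<in> J"
      then have [measurable]: "Y j \<in> borel_measurable M" by measurable
      have "(\<integral>\<^sup>+\<omega>. ennreal (?C j (count Z j) * Y j \<omega> ^ count Z j) \<partial>M) =
          (\<integral>\<^sup>+\<omega>. ennreal (?C j (count Z j)) * ennreal (Y j \<omega> ^ count Z j) \<partial>M)"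
        by (simp add: ennreal_mult')
      also have "\<dots> = ennreal (?C j (count Z j)) * ennreal (sym_beta_moment (r j) (count Z j))"
        by (subst nn_integral_cmult) (simp_all add: mom j)
      finally show "(\<integral>\<^sup>+\<omega>. ennreal (?C j (count Z j) * Y j \<omega> ^ count Z j) \<partial>M) =
          ennreal (?C j (count Z j) * sym_beta_moment (r j) (count Z j))"
        by (simp add: ennreal_mult')
    qed
    finally show "(\<integral>\<^sup>+\<omega>. (\<Prod>j\<in>J. ennreal (?C j (count Z j) * Y j \<omega> ^ count Z j)) \<partial>M) =
        (\<Prod>j\<in>J. ennreal (?C j (count Z j) * sym_beta_moment (r j) (count Z j)))" .
  qed
  also have "\<dots> = ennreal (\<Sum>Z\<in>?Z. \<Prod>j\<in>J. ?C j (count Z j) * sym_beta_moment (r j) (count Z j))"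
    by (simp add: prod_ennreal sum_ennreal prod_nonneg sym_beta_moment_nonneg)
  also have "\<dots> = ennreal (ballot (2 * (\<Sum>j\<in>J. r j)) m / 4 ^ m)"
    by (simp only: sum_multisets_ballot[OF J r])
  finally show ?thesis .
qed

theorem theorem3p1:
  fixes M :: "'a measure"
    and n k :: nat and N r :: "nat \<Rightarrow> nat" and a b :: real
    and U V X :: "nat \<Rightarrow> 'a \<Rightarrow> real"
  assumes "prob_space M"
    and "2 \<le> n" and "2 \<le> k" and "k \<le> n"
    and "N 0 = 0" and "N k = n" and "strict_mono_on {0..k} N"
    and r: "\<And>j. j \<in> {1..k} \<Longrightarrow> r j = N j - N (j - 1)"
    and "a < b"
    and "prob_space.indep_vars M (\<lambda>_. borel) U {1..<n}"
    and "\<And>i. i \<in> {1..<n} \<Longrightarrow>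
           distributed M lborel (U i) (\<lambda>x. indicator {0<..<1} x / measure lborel {0<..<1::real})"
    and V: "\<And>j \<omega>. j \<in> {1..k} \<Longrightarrow> V j \<omega> = random_weight n N (\<lambda>i. U i \<omega>) j"
    and "prob_space.indep_vars M (\<lambda>_. borel) X {1..k}"
    and "prob_space.indep_var M
           (Pi\<^sub>M {1..k} (\<lambda>_. borel)) (\<lambda>\<omega>. \<lambda>j\<in>{1..k}. V j \<omega>)
           (Pi\<^sub>M {1..k} (\<lambda>_. borel)) (\<lambda>\<omega>. \<lambda>i\<in>{1..k}. X i \<omega>)"
    and "\<And>i. i \<in> {1..k} \<Longrightarrow>
           distributed M lborel (X i) (\<lambda>x. ennreal (beta_density a b (r i + 1/2) (r i + 1/2) x))"
  shows "distributed M lborel (\<lambda>\<omega>. \<Sum>j=1..k. V j \<omega> * X j \<omega>)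
           (\<lambda>x. ennreal (beta_density a b ((\<Sum>i=1..k. r i) + 1/2) ((\<Sum>i=1..k. r i) + 1/2) x))"
proof -
  interpret prob_space M by fact
  note n = \<open>2 \<le> n\<close> and N0 = \<open>N 0 = 0\<close> and Nk = \<open>N k = n\<close> and N = \<open>strict_mono_on {0..k} N\<close> and ab
      = \<open>a < b\<close>
  note indepU = assms(10) and distU = assms(11) and indepX = assms(13) and indepVX
      = assms(14) and distX = assms(15)
  have n1: "1 \<le> n" and I: "finite {1..<n}" "{1..<n} \<noteq> {}" using n by auto
  let ?J = "{1..k}"
  define Y where "Y j \<omega> = (X j \<omega> - a) / (b - a)" for j \<omega>
  define S where "S \<omega> = (\<Sum>j=1..k. V j \<omega> * Y j \<omega>)" for \<omega>
  let ?y = "\<lambda>x i. if i < n then x (block N i) else 0"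
  let ?p = "real n + 1/2"

  have rpos: "0 < r j" if "j \<in> ?J" for j
    using r[OF that] strict_mono_onD[OF N, of "j - 1" j] that by auto
  have sumr: "(\<Sum>j=1..k. r j) = n"
  proof -
    \<comment> \<open>The telescoping takes place in the integers, since natural subtraction is
      truncated.\<close>
    have "(\<Sum>j=1..k. int (r j)) = (\<Sum>j=1..k. int (N j) - int (N (j - 1)))"
      using r rpos by (intro sum.cong) (auto intro!: of_nat_diff less_imp_le)
    also have "\<dots> = int (N k) - int (N 0)"
      using sum_telescope''[of 0 k "\<lambda>j. int (N j)"] by simp
    finally show ?thesis using Nk N0 by (simp add: of_nat_sum[symmetric] del: of_nat_sum)
  qed

  have [measurable]: "X j \<in> borel_measurable M" if "j \<in> ?J" for j
    using indepX that by (auto simp: indep_vars_def)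
  have Ym[measurable]: "Y j \<in> borel_measurable M" if "j \<in> ?J" for j
    unfolding Y_def[abs_def] using that by measurable
  have Um: "U i \<in> borel_measurable M" if "i \<in> {1..<n}" for i
    using indepU that by (auto simp: indep_vars_def)
  have "(\<lambda>\<omega>. \<lambda>j\<in>?J. V j \<omega>) \<in> measurable M (PiM ?J (\<lambda>_. borel))"
    using indepVX by (simp add: indep_var_distribution_eq)
  from measurable_compose[OF this measurable_component_singleton]
  have [measurable]: "V j \<in> borel_measurable M" if "j \<in> ?J" for j
    using that by fastforce
  have Sm[measurable]: "S \<in> borel_measurable M"
    unfolding S_def[abs_def] by measurable

  have Udist: "distr M borel (U i) = unif01" if "i \<in> {1..<n}" for i
  proof -
    have "distr M borel (U i) = distr M lborel (U i)" by (rule distr_cong) auto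
    also have "\<dots> = unif01"
      unfolding distributed_distr_eq_density[OF distU[OF that]]
      by (rule density_cong) (auto simp: indicator_def)
    finally show ?thesis .
  qed
  have AEU: "AE \<omega> in M. \<forall>i\<in>{1..<n}. U i \<omega> \<in> {0<..<1}"
    using Um Udist by (intro AE_unif01_range) auto
  have AEY: "AE \<omega> in M. \<forall>j\<in>?J. Y j \<omega> \<in> {0<..<1}"
    using rescaled_beta_distributed(1)[OF distX ab] unfolding Y_def by (intro AE_finite_allI) auto

  have weights: "(\<Sum>j=1..k. V j \<omega> * x j) = spacing_sum (?y x) {1..<n} (\<lambda>i. U i \<omega>) 1" for \<omega> x
    using sum_random_weight[OF N N0 Nk n1, of "\<lambda>i. U i \<omega>" x] V by simp
  have weights_1: "(\<Sum>j=1..k. V j \<omega>) = 1" for \<omega>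
  proof -
    have "(\<Sum>j=1..k. V j \<omega>) = (\<Sum>j=1..k. random_weight n N (\<lambda>i. U i \<omega>) j)"
      by (intro sum.cong refl V)
    also have "\<dots> = 1"
      by (rule sum_random_weight_1[OF N N0 Nk n1])
    finally show ?thesis .
  qed
  have y_nonneg: "0 \<le> ?y x i" if "\<And>j. j \<in> ?J \<Longrightarrow> 0 \<le> x j" for x :: "nat \<Rightarrow> real" and i
    using that block_mem[OF N N0, of i] Nk by simp

  have "AE \<omega> in M. 0 \<le> S \<omega> \<and> S \<omega> \<le> 1"
    using AEU AEY
  proof eventually_elim
    case (elim \<omega>)
    have pos: "0 \<le> (\<Sum>j=1..k. V j \<omega> * x j)" if "\<And>j. j \<in> ?J \<Longrightarrow> 0 \<le> x j" for x
      unfolding weights by (intro spacing_sum_nonneg y_nonneg that)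
          (use elim in \<open>auto intro: less_imp_le\<close>)
    \<comment> \<open>The upper bound is the same nonnegativity applied to \<open>1 - Y j\<close>,
      because the weights sum to 1.\<close>
    have "0 \<le> (\<Sum>j=1..k. V j \<omega> * (1 - Y j \<omega>))"
      by (rule pos) (use elim in \<open>auto intro: less_imp_le\<close>)
    also have "\<dots> = 1 - S \<omega>"
      using weights_1[of \<omega>] by (simp add: S_def right_diff_distrib sum_subtractf)
    finally have "S \<omega> \<le> 1" by simp
    moreover have "0 \<le> S \<omega>"
      unfolding S_def by (rule pos) (use elim in \<open>auto intro: less_imp_le\<close>)
    ultimately show ?case by simp
  qed
  moreover have "(\<integral>\<^sup>+\<omega>. ennreal (S \<omega> ^ m) \<partial>M) = ennreal (sym_beta_moment n m)" for m
  proof -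
    let ?c = "fact (n - 1) * fact m / fact (n - 1 + m) :: real"
    \<comment> \<open>The average is written as a function of the two independent vectors, so that
      the weights can be integrated while the values are held fixed.\<close>
    define g where "g = (\<lambda>(v, x). ennreal ((\<Sum>j=1..k. v j * ((x j - a) / (b - a))) ^ m))"
    have [measurable]: "g \<in> borel_measurable (PiM ?J (\<lambda>_. borel) \<Otimes>\<^sub>M PiM ?J (\<lambda>_. borel))"
      unfolding g_def by measurable
    have "(\<integral>\<^sup>+\<omega>. ennreal (S \<omega> ^ m) \<partial>M) = (\<integral>\<^sup>+\<omega>. g (\<lambda>j\<in>?J. V j \<omega>, \<lambda>j\<in>?J. X j \<omega>) \<partial>M)"
      by (simp add: g_def S_def Y_def)
    also have "\<dots> = (\<integral>\<^sup>+\<omega>. \<integral>\<^sup>+\<omega>'. g (\<lambda>j\<in>?J. V j \<omega>', \<lambda>j\<in>?J. X j \<omega>) \<partial>M \<partial>M)"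
      by (rule nn_integral_indep_var[OF indepVX]) measurable
    also have "\<dots> = (\<integral>\<^sup>+\<omega>. \<integral>\<^sup>+\<omega>'. ennreal ((\<Sum>j=1..k. V j \<omega>' * Y j \<omega>) ^ m) \<partial>M \<partial>M)"
      by (simp add: g_def Y_def)
    also have "\<dots> = (\<integral>\<^sup>+\<omega>. ennreal ?c * ennreal (fps_nth (\<Prod>j\<in>?J. Abs_fps (\<lambda>l. Y j \<omega> ^ l) ^ r j) m) \<partial>M)"
    proof (rule nn_integral_cong_AE)
      show "AE \<omega> in M. (\<integral>\<^sup>+\<omega>'. ennreal ((\<Sum>j=1..k. V j \<omega>' * Y j \<omega>) ^ m) \<partial>M) =
          ennreal ?c * ennreal (fps_nth (\<Prod>j\<in>?J. Abs_fps (\<lambda>l. Y j \<omega> ^ l) ^ r j) m)"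
        using AEY
      proof eventually_elim
        case (elim \<omega>)
        have "(\<integral>\<^sup>+\<omega>'. ennreal ((\<Sum>j=1..k. V j \<omega>' * Y j \<omega>) ^ m) \<partial>M) =
          ennreal (fact (card {1..<n}) * fact m / fact (card {1..<n} + m) *
            complete_homogeneous (?y (\<lambda>j. Y j \<omega>)) (Suc (card {1..<n})) m)"
          unfolding weights
          by (intro nn_integral_spacing_sum_power I indepU Udist y_nonneg)
              (use elim in \<open>auto intro: less_imp_le\<close>)
        also have "\<dots> = ennreal (?c * complete_homogeneous (?y (\<lambda>j. Y j \<omega>)) n m)"
          using n1 by simp
        also have "complete_homogeneous (?y (\<lambda>j. Y j \<omega>)) n m
            = fps_nth (\<Prod>j\<in>?J. Abs_fps (\<lambda>l. Y j \<omega> ^ l) ^ r j) m"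
          using complete_homogeneous_block[OF N N0 Nk, of "\<lambda>j. Y j \<omega>" m] r by simp
        finally show ?case by (simp only: ennreal_mult' divide_nonneg_nonneg mult_nonneg_nonneg fact_ge_zero)
      qed
    qed
    also have "\<dots> = ennreal ?c * ennreal (ballot (2 * (\<Sum>j=1..k. r j)) m / 4 ^ m)"
    proof -
      have indepY: "indep_vars (\<lambda>_. borel) Y ?J"
        unfolding Y_def[abs_def] by (rule indep_vars_compose2[OF indepX]) measurable
      have mom: "(\<integral>\<^sup>+\<omega>. ennreal (Y j \<omega> ^ m) \<partial>M) = ennreal (sym_beta_moment (r j) m)" if "j \<in> ?J" for j m
        unfolding Y_def by (rule rescaled_beta_distributed(2)[OF distX[OF that] ab])
      have pos: "AE \<omega> in M. 0 \<le> Y j \<omega>" if "j \<in> ?J" for j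
        using AEY by eventually_elim (use that in \<open>auto intro: less_imp_le\<close>)
      \<comment> \<open>Expanding over multisets turns this coefficient into a polynomial in the
        \<open>Y j\<close>, which is visibly measurable.\<close>
      have [measurable]: "(\<lambda>\<omega>. fps_nth (\<Prod>j\<in>?J. Abs_fps (\<lambda>l. Y j \<omega> ^ l) ^ r j) m) \<in> borel_measurable M"
      proof -
        have "fps_nth (Abs_fps (\<lambda>l. Y j \<omega> ^ l) ^ r j) i
            = real ((r j - 1 + i) choose i) * Y j \<omega> ^ i" if "j \<in> ?J" for i j \<omega>
          using fps_nth_geometric_power[of "Y j \<omega>" "r j - 1" i] rpos[OF that] by simp
        then have "(\<lambda>\<omega>. fps_nth (\<Prod>j\<in>?J. Abs_fps (\<lambda>l. Y j \<omega> ^ l) ^ r j) m) =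
            (\<lambda>\<omega>. \<Sum>Z\<in>multisets_of_size ?J m. \<Prod>j\<in>?J. real ((r j - 1 + count Z j) choose count Z j)
                * Y j \<omega> ^ count Z j)"
          by (simp add: fps_prod_nth')
        then show ?thesis by simp
      qed
      show ?thesis
        by (subst nn_integral_cmult)
           (simp_all only: nn_integral_prod_geometric_power[OF _ rpos indepY pos mom] finite_atLeastAtMost, measurable)
    qed
    \<comment> \<open>The coefficient identity is now read backwards with \<open>n\<close> in place
      of \<open>r\<close>, producing the moment of the target law; its binomial coefficient is the
      reciprocal of \<open>?c\<close>.\<close>
    also have "ballot (2 * (\<Sum>j=1..k. r j)) m / 4 ^ m
        = real ((n - 1 + m) choose m) * sym_beta_moment n m"
      unfolding sumr using n1 by (subst choose_times_moment) auto
    also have "ennreal ?c * ennreal (real ((n - 1 + m) choose m) * sym_beta_moment n m)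
        = ennreal (sym_beta_moment n m)"
    proof -
      have "real ((n - 1 + m) choose m) = fact (n - 1 + m) / (fact m * fact (n - 1))"
        by (subst binomial_fact) auto
      then show ?thesis
        by (subst ennreal_mult'[symmetric]) simp_all
    qed
    finally show ?thesis .
  qed
  moreover define B where "B = density lborel (\<lambda>x. ennreal (beta_density 0 1 ?p ?p x))"
  moreover have mB: "(\<integral>\<^sup>+x. ennreal (x ^ m) \<partial>B) = ennreal (sym_beta_moment n m)" for m
    unfolding B_def using nn_integral_beta_density_power[of ?p ?p m]
    by (subst nn_integral_density) (auto simp: sym_beta_moment_def)
  moreover have "AE x in B. 0 \<le> x \<and> x \<le> 1"
    unfolding B_def by (subst AE_density) (auto simp: beta_density_def)
  moreover have "prob_space B"
  proof
    have "Beta ?p ?p > 0"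
      unfolding Beta_def by (intro mult_pos_pos divide_pos_pos Gamma_real_pos) auto
    \<comment> \<open>The total mass of \<open>B\<close> is its zeroth moment.\<close>
    then have "sym_beta_moment n 0 = 1" by (simp add: sym_beta_moment_def)
    then show "emeasure B (space B) = 1" using mB[of 0] by simp
  qed
  ultimately have "distr M borel S = distr B borel (\<lambda>x. x)"
    using prob_space_axioms Sm by (intro distr_eq_of_moments) (auto simp: B_def)
  also have "\<dots> = B"
    unfolding B_def by (rule distr_id2) simp
  finally have "distributed M lborel S (\<lambda>x. ennreal (beta_density 0 1 ?p ?p x))"
    using Sm by (simp add: distributed_def B_def cong: distr_cong)
  then have "distributed M lborel (\<lambda>\<omega>. a + (b - a)
      * S \<omega>) (\<lambda>x. ennreal (beta_density 0 1 ?p ?p ((x - a) / (b - a))) / ennreal \<bar>b - a\<bar>)"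
    using ab by (intro distributed_affine) auto
  \<comment> \<open>The affine map passes through the average because the weights sum to 1 at every
    outcome.\<close>
  moreover have "a + (b - a) * S \<omega> = (\<Sum>j=1..k. V j \<omega> * X j \<omega>)" for \<omega>
  proof -
    have "a + (b - a) * S \<omega> = (\<Sum>j=1..k. V j \<omega> * a) + (\<Sum>j=1..k. V j \<omega> * ((b - a) * Y j \<omega>))"
      unfolding sum_distrib_right[symmetric] weights_1 by (simp add: S_def sum_distrib_left mult_ac)
    also have "\<dots> = (\<Sum>j=1..k. V j \<omega> * X j \<omega>)"
      using ab unfolding sum.distrib[symmetric]
          by (intro sum.cong) (simp_all add: Y_def distrib_left[symmetric])
    finally show ?thesis .
  qed
  moreover have "ennreal (beta_density 0 1 ?p ?p ((x - a) / (b - a))) / ennreal \<bar>b - a\<bar>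
      = ennreal (beta_density a b ?p ?p x)" for x
    using beta_density_affine[OF ab, of ?p ?p "(x - a)
        / (b - a)"] ab beta_density_nonneg[of ?p ?p 0 1 "(x - a) / (b - a)"]
    by (simp add: divide_ennreal)
  ultimately show ?thesis unfolding sumr by simp
qed

end
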